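(* Let $q\ge 3$ be odd, $d\ge 2$, and let $\sigma$ be a non-degenerate quadratic form on $\mathbb{F}_q^n$ defining a polar space of type $O(2d+1,q)$ (with $n=2d+1$), $O^+(2d,q)$ or $O^-(2d,q)$ (with $n=2d$); let $\perp$ be the associated polarity. Let $V_+$ (resp. $V_-$) be the set of points $\langle v\rangle$ with $\sigma(v)$ a nonzero square (resp. a non-square) in $\mathbb{F}_q$, fix $\epsilon\in\{+,-\}$, and let $\Gamma_\epsilon$ be the graph with vertex set $V_\epsilon$, two points $x,y$ adjacent iff $x\subseteq y^\perp$. Let $3\le m\le d$ and let $L_1,L_2$ be $(m-1)$-dimensional subspaces, not totally isotropic, such that $p:=L_1\cap L_2$ has dimension $m-2$ and $p=L_1\cap L_1^\perp=L_2\cap L_2^\perp$; put $P=L_1+L_2$. Let $C_1$ be the set of points of $L_1$ not in $L_2$ and $C_2$ the set of points of $L_2$ not in $L_1$, and suppose all points of $C_1\cup C_2$ lie in $V_\epsilon$. Then: (i) $\{C_1,C_2\}$ is a switching set of $\Gamma_\epsilon$. (ii) Let $\delta=-$ if $q\equiv 3\pmod 4$ and $\delta=+$ if $q\equiv 1\pmod 4$. If $m=3$, $P/p$ with the induced form is isomorphic to $O^\delta(2,q)$, and $n\ge 7$, then the graph $\overline{\Gamma}_\epsilon$ obtained from $\Gamma_\epsilon$ by switching with respect to $\{C_1,C_2\}$ is not isomorphic to $\Gamma_\epsilon$.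
   Context: Points are $1$-dimensional subspaces. $O^+(2,q)$ (resp. $O^-(2,q)$) denotes a non-degenerate $2$-dimensional quadratic space containing (resp. not containing) nonzero singular vectors. For a vertex $x$, $\Gamma(x)$ is its neighbourhood. For disjoint vertex sets $C_1,C_2$ of a graph $\Gamma$ with $D$ the remaining vertices: $\{C_1,C_2\}$ is a switching set if $|C_1|=|C_2|$, the induced subgraphs on $C_1$, $C_2$, $C_1\cup C_2$ are regular with equal degrees on $C_1$ and $C_2$, and every $x\in D$ satisfies $|\Gamma(x)\cap C_1|=|\Gamma(x)\cap C_2|$ or $\Gamma(x)\cap(C_1\cup C_2)\in\{C_1,C_2\}$. The graph $\overline{\Gamma}$ obtained by switching has the same vertices, the same edges inside $C_1\cup C_2$ and inside $D$, and for $x\in D$: $\overline{\Gamma}(x)\cap(C_1\cup C_2)$ equals $C_1$ if $\Gamma(x)\cap(C_1\cup C_2)=C_2$, equals $C_2$ if $\Gamma(x)\cap(C_1\cup C_2)=C_1$, and equals $\Gamma(x)\cap(C_1\cup C_2)$ otherwise. *)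

theory Defs
  imports "HOL-Analysis.Analysis" "HOL-Library.Set_Algebras"
begin

subsection \<open>Quadratic forms\<close>

definition polar :: "('a::field ^ 'n \<Rightarrow> 'a) \<Rightarrow> 'a ^ 'n \<Rightarrow> 'a ^ 'n \<Rightarrow> 'a" where
  "polar \<sigma> u v = \<sigma> (u + v) - \<sigma> u - \<sigma> v"

definition quadratic_form :: "('a::field ^ 'n \<Rightarrow> 'a) \<Rightarrow> bool" where
  "quadratic_form \<sigma> \<longleftrightarrow>
     (\<forall>c v. \<sigma> (c *s v) = c\<^sup>2 * \<sigma> v) \<and>
     (\<forall>u. Vector_Spaces.linear (*s) (*) (\<lambda>v. polar \<sigma> u v)) \<and>
     (\<forall>v. Vector_Spaces.linear (*s) (*) (\<lambda>u. polar \<sigma> u v))"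

definition perp :: "('a::field ^ 'n \<Rightarrow> 'a) \<Rightarrow> ('a ^ 'n) set \<Rightarrow> ('a ^ 'n) set" where
  "perp \<sigma> S = {v. \<forall>s\<in>S. polar \<sigma> v s = 0}"

text \<open>Only used in odd characteristic, where a trivial radical of the polar form is the usual
  notion of non-degeneracy.\<close>

definition nondegenerate :: "('a::field ^ 'n \<Rightarrow> 'a) \<Rightarrow> bool" where
  "nondegenerate \<sigma> \<longleftrightarrow> perp \<sigma> UNIV = {0}"

definition totally_isotropic :: "('a::field ^ 'n \<Rightarrow> 'a) \<Rightarrow> ('a ^ 'n) set \<Rightarrow> bool" where
  "totally_isotropic \<sigma> S \<longleftrightarrow> S \<subseteq> perp \<sigma> S"

definition totally_singular :: "('a::field ^ 'n \<Rightarrow> 'a) \<Rightarrow> ('a ^ 'n) set \<Rightarrow> bool" where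
  "totally_singular \<sigma> S \<longleftrightarrow> (\<forall>v\<in>S. \<sigma> v = 0)"

definition witt_index :: "('a::field ^ 'n \<Rightarrow> 'a) \<Rightarrow> nat" where
  "witt_index \<sigma> = Max {vec.dim S | S. vec.subspace S \<and> totally_singular \<sigma> S}"

text \<open>The types \<open>O(2d+1,q)\<close>, \<open>O\<^sup>+(2d,q)\<close> and \<open>O\<^sup>-(2d,q)\<close>, where \<open>q\<close> is the order of the field.
  In odd dimension over a finite field of odd order the polar space is determined by the dimension;
  in even dimension the two types are told apart by the Witt index.\<close>

definition type_O_odd :: "nat \<Rightarrow> ('a::field ^ 'n \<Rightarrow> 'a) \<Rightarrow> bool" where
  "type_O_odd d \<sigma> \<longleftrightarrow> quadratic_form \<sigma> \<and> nondegenerate \<sigma> \<and>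
     CARD('n) = 2 * d + 1"

definition type_O_plus :: "nat \<Rightarrow> ('a::field ^ 'n \<Rightarrow> 'a) \<Rightarrow> bool" where
  "type_O_plus d \<sigma> \<longleftrightarrow> quadratic_form \<sigma> \<and> nondegenerate \<sigma> \<and>
     CARD('n) = 2 * d \<and> witt_index \<sigma> = d"

definition type_O_minus :: "nat \<Rightarrow> ('a::field ^ 'n \<Rightarrow> 'a) \<Rightarrow> bool" where
  "type_O_minus d \<sigma> \<longleftrightarrow> quadratic_form \<sigma> \<and> nondegenerate \<sigma> \<and>
     CARD('n) = 2 * d \<and> witt_index \<sigma> + 1 = d"

datatype sign = Pos | Neg

text \<open>A quadratic form on the plane making it an \<open>O\<^sup>+(2,q)\<close> or an \<open>O\<^sup>-(2,q)\<close>.\<close>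

definition type_O2 :: "sign \<Rightarrow> ('a::field ^ 2 \<Rightarrow> 'a) \<Rightarrow> bool" where
  "type_O2 s \<tau> \<longleftrightarrow> quadratic_form \<tau> \<and> nondegenerate \<tau> \<and>
     (case s of Pos \<Rightarrow> \<exists>v. v \<noteq> 0 \<and> \<tau> v = 0 | Neg \<Rightarrow> \<not> (\<exists>v. v \<noteq> 0 \<and> \<tau> v = 0))"

text \<open>The quotient \<open>P/p\<close> is the set of cosets \<open>v +o p\<close> with \<open>v\<close> in \<open>P\<close>; its operations and the
  induced form are those of representatives. The map \<open>\<phi>\<close> is a linear isometry from \<open>P/p\<close> onto
  the quadratic space given by \<open>\<tau>\<close>.\<close>

definition quotient_isometric ::
  "('a::field ^ 'n \<Rightarrow> 'a) \<Rightarrow> ('a ^ 'n) set \<Rightarrow> ('a ^ 'n) set \<Rightarrow> ('a ^ 'k \<Rightarrow> 'a) \<Rightarrow> bool" where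
  "quotient_isometric \<sigma> P p \<tau> \<longleftrightarrow>
     (\<exists>\<phi>. bij_betw \<phi> ((\<lambda>v. v +o p) ` P) UNIV \<and>
       (\<forall>u\<in>P. \<forall>v\<in>P. \<phi> ((u + v) +o p) = \<phi> (u +o p) + \<phi> (v +o p)) \<and>
       (\<forall>c. \<forall>v\<in>P. \<phi> ((c *s v) +o p) = c *s \<phi> (v +o p)) \<and>
       (\<forall>v\<in>P. \<tau> (\<phi> (v +o p)) = \<sigma> v))"

definition points :: "('a::field ^ 'n) set set" where
  "points = {x. vec.subspace x \<and> vec.dim x = 1}"

definition points_of_sign :: "('a::field ^ 'n \<Rightarrow> 'a) \<Rightarrow> sign \<Rightarrow> ('a ^ 'n) set set" where
  "points_of_sign \<sigma> \<epsilon> = (case \<epsilon> of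
      Pos \<Rightarrow> {vec.span {v} | v. \<sigma> v \<noteq> 0 \<and> (\<exists>a. \<sigma> v = a\<^sup>2)}
    | Neg \<Rightarrow> {vec.span {v} | v. \<not> (\<exists>a. \<sigma> v = a\<^sup>2)})"


subsection \<open>Graphs and switching\<close>

text \<open>Only the restriction of \<open>adj\<close> to \<open>verts\<close> is meaningful.\<close>

record 'v graph =
  verts :: "'v set"
  adj :: "'v \<Rightarrow> 'v \<Rightarrow> bool"

definition nbhd :: "'v graph \<Rightarrow> 'v \<Rightarrow> 'v set" where
  "nbhd G x = {y \<in> verts G. adj G x y}"

definition graph_iso :: "'v graph \<Rightarrow> 'w graph \<Rightarrow> bool" where
  "graph_iso G H \<longleftrightarrow> (\<exists>f. bij_betw f (verts G) (verts H) \<and>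
     (\<forall>x\<in>verts G. \<forall>y\<in>verts G. adj G x y \<longleftrightarrow> adj H (f x) (f y)))"

definition induced_regular :: "'v graph \<Rightarrow> 'v set \<Rightarrow> nat \<Rightarrow> bool" where
  "induced_regular G S k \<longleftrightarrow> (\<forall>x\<in>S. card (nbhd G x \<inter> S) = k)"

definition switching_set :: "'v graph \<Rightarrow> 'v set \<Rightarrow> 'v set \<Rightarrow> bool" where
  "switching_set G C\<^sub>1 C\<^sub>2 \<longleftrightarrow>
     finite (verts G) \<and> C\<^sub>1 \<subseteq> verts G \<and> C\<^sub>2 \<subseteq> verts G \<and> C\<^sub>1 \<inter> C\<^sub>2 = {} \<and>
     card C\<^sub>1 = card C\<^sub>2 \<and>
     (\<exists>k. induced_regular G C\<^sub>1 k \<and> induced_regular G C\<^sub>2 k) \<and>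
     (\<exists>l. induced_regular G (C\<^sub>1 \<union> C\<^sub>2) l) \<and>
     (\<forall>x \<in> verts G - (C\<^sub>1 \<union> C\<^sub>2).
        card (nbhd G x \<inter> C\<^sub>1) = card (nbhd G x \<inter> C\<^sub>2) \<or>
        nbhd G x \<inter> (C\<^sub>1 \<union> C\<^sub>2) \<in> {C\<^sub>1, C\<^sub>2})"

definition switched_nbhd :: "'v graph \<Rightarrow> 'v set \<Rightarrow> 'v set \<Rightarrow> 'v \<Rightarrow> 'v set" where
  "switched_nbhd G C\<^sub>1 C\<^sub>2 x =
     (let N = nbhd G x \<inter> (C\<^sub>1 \<union> C\<^sub>2)
      in if N = C\<^sub>2 then C\<^sub>1 else if N = C\<^sub>1 then C\<^sub>2 else N)"

definition switch :: "'v graph \<Rightarrow> 'v set \<Rightarrow> 'v set \<Rightarrow> 'v graph" where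
  "switch G C\<^sub>1 C\<^sub>2 =
     \<lparr>verts = verts G,
      adj = (\<lambda>x y.
        let C = C\<^sub>1 \<union> C\<^sub>2; D = verts G - C in
        if x \<in> D \<and> y \<in> C then y \<in> switched_nbhd G C\<^sub>1 C\<^sub>2 x
        else if x \<in> C \<and> y \<in> D then x \<in> switched_nbhd G C\<^sub>1 C\<^sub>2 y
        else adj G x y)\<rparr>"

text \<open>There are no loops in odd characteristic, since a vertex is never contained in its own
  perpendicular space.\<close>

definition polar_graph :: "('a::field ^ 'n \<Rightarrow> 'a) \<Rightarrow> sign \<Rightarrow> ('a ^ 'n) set graph" where
  "polar_graph \<sigma> \<epsilon> = \<lparr>verts = points_of_sign \<sigma> \<epsilon>, adj = (\<lambda>x y. x \<subseteq> perp \<sigma> y)\<rparr>"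

end

theory Submission
  imports Defs "HOL-Computational_Algebra.Nth_Powers"
begin

text \<open>
  Write \<open>b\<close> for half the polar form and \<open>L\<^sub>i = p + \<langle>v\<^sub>i\<rangle>\<close> with \<open>b v\<^sub>1 v\<^sub>1 = b v\<^sub>2 v\<^sub>2 = e\<close>; then \<open>C\<^sub>i\<close>
  consists of the points \<open>\<langle>v\<^sub>i + w\<rangle>\<close> with \<open>w \<in> p\<close>. A vector perpendicular to \<open>p\<close> sees all or
  nothing of \<open>C\<^sub>i\<close>; for any other vector the solutions \<open>w\<close> of \<open>b u (v\<^sub>i + w) = 0\<close> form a fibre of
  a nonzero functional on \<open>p\<close>. This gives the switching set.

  For the second part, products of reflections act transitively on the lists of \<open>k\<close> mutually
  orthogonal vectors of value \<open>e\<close>, so in \<open>\<Gamma>\<close> the number of common neighbours of a \<open>k\<close>-clique depends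
  on \<open>k\<close> only. This fails for some cliques of size \<open>n - 3\<close> of the switched graph. With
  \<open>p = \<langle>p0\<rangle>\<close>, choose \<open>z\<close> of value \<open>e\<close> with \<open>b z p0 = e\<close> and \<open>v\<^sub>1, v\<^sub>2 \<bottom> z\<close>. The type of \<open>P/p\<close> says
  that \<open>v\<^sub>1 = a v\<^sub>2 + r v'\<close> with \<open>v' \<bottom> v\<^sub>2\<close> of value \<open>e\<close>, \<open>a\<^sup>2 + r\<^sup>2 = 1\<close> and \<open>r \<noteq> 0\<close>.
  Take \<open>n - 5\<close> orthonormal (up to \<open>e\<close>) vectors \<open>Y\<close> in \<open>{p0, z, v\<^sub>2}\<^sup>\<bottom>\<close>. Both \<open>{v\<^sub>2, z} \<union> Y\<close> in \<open>\<Gamma>\<close>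
  and \<open>{v\<^sub>1, z} \<union> Y\<close> in the switched graph are cliques; they have the same common neighbours
  perpendicular to \<open>p\<close>, and the other ones are counted by
  \<open>\<alpha> i\<^sup>2 + \<beta> j\<^sup>2 - t\<^sup>2 = 1\<close>, \<open>t \<noteq> 0\<close>, for binary forms \<open>(\<alpha>, \<beta>)\<close> whose discriminants differ by a
  non-square as soon as \<open>a\<^sup>2 + r\<^sup>2 s0\<close> is a non-square, where \<open>e s0\<close> is the value of the component of
  \<open>v'\<close> perpendicular to \<open>Y\<close>. Then the two counts differ. Since \<open>n - 5 \<ge> 2\<close> and \<open>1 - s0\<close> is a sum of
  two squares, \<open>Y\<close> can be chosen with any prescribed \<open>s0 \<noteq> 0\<close>.
\<close>

subsection \<open>Squares and quadrics over a finite field of odd order\<close>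

text \<open>The orbits \<open>{x, f x}\<close> all have size two, and the induction removes one
  orbit at a time.\<close>

lemma even_card_involution:
  assumes "finite A" "\<And>x. x \<in> A \<Longrightarrow> f x \<in> A \<and> f (f x) = x \<and> f x \<noteq> x"
  shows "even (card A)"
  using assms
proof (induction A rule: finite_psubset_induct)
  case (psubset A)
  show ?case
  proof (cases "A = {}")
    case False
    then obtain x where x: "x \<in> A" by blast
    let ?B = "A - {x, f x}"
    have "even (card ?B)"
    proof (rule psubset.IH)
      show "?B \<subset> A" using x by blast
      show "f y \<in> ?B \<and> f (f y) = y \<and> f y \<noteq> y" if "y \<in> ?B" for y
        using that psubset.prems[of y] psubset.prems[OF x] by auto
    qed
    moreover have "card A = card ?B + 2"
    proof -
      have "card {x, f x} = 2" using psubset.prems[OF x] by auto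
      moreover have "{x, f x} \<subseteq> A" using x psubset.prems by blast
      ultimately show ?thesis
        using card_Diff_subset[of "{x, f x}" A] card_mono[OF psubset.hyps, of "{x, f x}"] by simp
    qed
    ultimately show ?thesis by simp
  qed simp
qed

text \<open>Every fibre is a pair \<open>{x, - x}\<close>. This serves both for the squaring map on
  nonzero scalars and for the passage from vectors of a fixed nonzero value to the points that they
  span.\<close>

lemma card_image_two_to_one:
  fixes f :: "'b::group_add \<Rightarrow> 'c"
  assumes fin: "finite X"
    and neg: "\<And>x. x \<in> X \<Longrightarrow> - x \<in> X \<and> - x \<noteq> x"
    and fib: "\<And>x y. x \<in> X \<Longrightarrow> y \<in> X \<Longrightarrow> f x = f y \<longleftrightarrow> y = x \<or> y = - x"
  shows "card X = 2 * card (f ` X)"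
proof -
  have "card X = (\<Sum>z\<in>f ` X. card {x \<in> X. f x = z})"
    using sum.image_gen[OF fin, of "\<lambda>_. 1::nat" f] by simp
  also have "\<dots> = (\<Sum>z\<in>f ` X. 2)"
  proof (rule sum.cong)
    fix z assume "z \<in> f ` X"
    then obtain x where x: "x \<in> X" "z = f x" by blast
    have "{y \<in> X. f y = z} = {x, - x}"
      using x fib[OF x(1)] fib[OF _ x(1)] neg[OF x(1)] by auto
    then show "card {y \<in> X. f y = z} = 2"
      using neg[OF x(1)] by (metis card_2_iff)
  qed simp
  finally show ?thesis by simp
qed

text \<open>In characteristic two, translation by 1 would be an involution without fixed points,
  making the order even.\<close>

lemma two_nonzero_if_odd_card:
  assumes "odd CARD('a::{field,finite})"
  shows "(2::'a) \<noteq> 0"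
proof
  assume "(2::'a) = 0"
  then have "\<And>x::'a. x + 1 + 1 = x"
    by (metis add.assoc add.right_neutral one_add_one)
  then have "even CARD('a)"
    by (intro even_card_involution[where f = "\<lambda>x. x + 1"]) auto
  with assms show False by simp
qed

lemma neg_neq_self:
  fixes x :: "'a::field"
  assumes "(2::'a) \<noteq> 0" "x \<noteq> 0"
  shows "- x \<noteq> x"
proof
  assume "- x = x"
  then have "2 * x = 0" by (metis add.right_inverse mult_2)
  with assms show False by simp
qed

text \<open>The coordinate \<open>t\<close> will be, up to a nonzero factor, the pairing with a
  generator of \<open>p\<close>, so \<open>t \<noteq> 0\<close> selects the vectors that are not
  perpendicular to \<open>p\<close>.\<close>

definition quadric_count :: "'a::field \<Rightarrow> 'a \<Rightarrow> nat" where
  "quadric_count \<alpha> \<beta> = card {(i, j, t). \<alpha> * i\<^sup>2 + \<beta> * j\<^sup>2 - t\<^sup>2 = 1 \<and> t \<noteq> 0}"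

context
  assumes two: "(2::'a::{field,finite}) \<noteq> 0"
begin

lemma card_nonzero_squares: "CARD('a) = 2 * card {x::'a. x \<noteq> 0 \<and> is_square x} + 1"
proof -
  have "card (UNIV - {0::'a}) = 2 * card ((\<lambda>x. x\<^sup>2) ` (UNIV - {0::'a}))"
    by (rule card_image_two_to_one) (auto simp: neg_neq_self[OF two] power2_eq_iff)
  moreover have "(\<lambda>x. x\<^sup>2) ` (UNIV - {0::'a}) = {x. x \<noteq> 0 \<and> is_square x}"
    by (auto simp: is_nth_power_def)
  ultimately show ?thesis
    by (metis Suc_eq_plus1 UNIV_I card_Suc_Diff1 finite_class.finite_UNIV)
qed

lemma card_squares: "2 * card {x::'a. is_square x} = CARD('a) + 1"
proof -
  have "{x::'a. is_square x} = insert 0 {x. x \<noteq> 0 \<and> is_square x}"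
    by auto
  then have "card {x::'a. is_square x} = Suc (card {x::'a. x \<noteq> 0 \<and> is_square x})"
    by simp
  with card_nonzero_squares show ?thesis by simp
qed

lemma card_nonsquares: "2 * card {x::'a. \<not> is_square x} + 1 = CARD('a)"
proof -
  have "card {x::'a. \<not> is_square x} = CARD('a) - card {x::'a. is_square x}"
    by (simp add: card_Diff_subset[symmetric] Compl_eq_Diff_UNIV[symmetric] Collect_neg_eq)
  with card_squares show ?thesis by simp
qed

lemma nonsquare_exists: "\<exists>g::'a. \<not> is_square g"
proof (rule ccontr)
  assume "\<not> ?thesis"
  then have "CARD('a) = 1"
    using card_nonsquares by simp
  moreover have "card {0, 1::'a} \<le> CARD('a)"
    by (rule card_mono) auto
  ultimately show False by simp
qed

text \<open>Multiplication by \<open>g\<close> maps the nonzero squares injectively into the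
  non-squares. Both sets have (q - 1) / 2 elements, so the map is onto and \<open>h\<close> is
  \<open>g\<close> times a square.\<close>

lemma nonsquare_mult_nonsquare:
  fixes g h :: 'a
  assumes "\<not> is_square g" "\<not> is_square h"
  shows "is_square (g * h)"
proof -
  have g0: "g \<noteq> 0" using assms(1) by auto
  have nsq: "\<not> is_square (g * x)" if "x \<noteq> 0" "is_square x" for x
  proof
    assume "is_square (g * x)"
    with that obtain y z where "x = y\<^sup>2" "g * x = z\<^sup>2" by (auto simp: is_nth_power_def)
    with that(1) have "g = (z / y)\<^sup>2" by (simp add: field_simps)
    with assms(1) show False by (auto simp: is_nth_power_def)
  qed
  have "(*) g ` {x. x \<noteq> 0 \<and> is_square x} = {x. \<not> is_square x}"
  proof (rule card_subset_eq)
    have "card ((*) g ` {x. x \<noteq> 0 \<and> is_square x}) = card {x::'a. x \<noteq> 0 \<and> is_square x}"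
      using g0 by (intro card_image inj_onI) simp
    then show "card ((*) g ` {x. x \<noteq> 0 \<and> is_square x}) = card {x::'a. \<not> is_square x}"
      using card_nonzero_squares card_nonsquares by simp
  qed (use nsq in auto)
  then obtain x where x: "is_square x" "h = g * x" using assms(2) by blast
  then obtain y where "x = y\<^sup>2" by (auto simp: is_nth_power_def)
  then have "g * h = (g * y)\<^sup>2" using x by (simp add: power2_eq_square)
  then show ?thesis by (auto simp: is_nth_power_def)
qed

text \<open>Inversion pairs off the nonzero squares other than 1 and -1, and 1 is always a square.
  Hence the number (q - 1) / 2 of nonzero squares is even exactly when -1 is one of them.\<close>

lemma is_square_minus_one_iff: "is_square (- 1 :: 'a) \<longleftrightarrow> CARD('a) mod 4 = 1"
proof -
  let ?S = "{x::'a. x \<noteq> 0 \<and> is_square x}"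
  have "even (card (?S - {1, -1}))"
  proof (rule even_card_involution[where f = inverse])
    fix x :: 'a assume x: "x \<in> ?S - {1, -1}"
    then obtain y where "x = y\<^sup>2" by (auto simp: is_nth_power_def)
    then have "is_square (inverse x)" by (auto simp: is_nth_power_def power_inverse[symmetric])
    moreover have "inverse x \<noteq> x"
    proof
      assume "inverse x = x"
      then have "x\<^sup>2 = 1" using x by (simp add: power2_eq_square) (metis right_inverse)
      with x show False by (simp add: power2_eq_1_iff)
    qed
    moreover have "inverse x \<noteq> 1" "inverse x \<noteq> -1" using x
      by (metis Diff_iff insertI1 inverse_1 inverse_inverse_eq,
          metis Diff_iff insertI1 insertI2 inverse_1 inverse_inverse_eq inverse_minus_eq)
    ultimately show "inverse x \<in> ?S - {1, -1} \<and> inverse (inverse x) = x \<and> inverse x \<noteq> x"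
      using x by auto
  qed simp
  moreover have "card ?S = card (?S - {1, -1}) + (if is_square (-1::'a) then 2 else 1)"
  proof -
    have one: "is_square (1::'a)" by (auto simp: is_nth_power_def intro: exI[of _ 1])
    have "card ?S = card (?S - {1, -1}) + card (?S \<inter> {1, -1})"
      by (metis (no_types, lifting) add.commute card_Int_Diff finite_class.finite_UNIV finite_subset top_greatest)
    moreover have "?S \<inter> {1, -1} = (if is_square (-1::'a) then {1, -1} else {1})"
      using one by auto
    moreover have "(1::'a) \<noteq> -1" using neg_neq_self[OF two, of 1] by simp
    ultimately show ?thesis by simp
  qed
  ultimately have "even (card ?S) \<longleftrightarrow> is_square (-1::'a)" by simp
  moreover have "CARD('a) mod 4 = 1 \<longleftrightarrow> even (card ?S)"
    unfolding card_nonzero_squares by presburger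
  ultimately show ?thesis by blast
qed

text \<open>Pigeonhole: the values of \<open>\<alpha> * i\<^sup>2\<close> and those of
  \<open>c - \<beta> * j\<^sup>2\<close> form two sets of (q + 1) / 2 elements each, which must
  meet.\<close>

lemma binary_form_universal:
  fixes \<alpha> \<beta> c :: 'a
  assumes "\<alpha> \<noteq> 0" "\<beta> \<noteq> 0"
  obtains i j where "\<alpha> * i\<^sup>2 + \<beta> * j\<^sup>2 = c"
proof -
  let ?S = "{x::'a. is_square x}"
  let ?X = "(\<lambda>x. \<alpha> * x) ` ?S" and ?Y = "(\<lambda>x. c - \<beta> * x) ` ?S"
  have "card ?X = card ?S" "card ?Y = card ?S"
    using assms by (auto intro!: card_image inj_onI)
  then have "card ?X + card ?Y > CARD('a)" using card_squares by simp
  moreover have "card (?X \<union> ?Y) \<le> CARD('a)" by (rule card_mono) auto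
  moreover have "card (?X \<union> ?Y) = card ?X + card ?Y" if "?X \<inter> ?Y = {}"
    using that by (intro card_Un_disjoint) auto
  ultimately have "?X \<inter> ?Y \<noteq> {}" by fastforce
  then obtain x y where "is_square x" "is_square y" "\<alpha> * x = c - \<beta> * y" by blast
  then obtain i j where "\<alpha> * i\<^sup>2 = c - \<beta> * j\<^sup>2" by (auto simp: is_nth_power_def)
  then show thesis by (intro that[of i j]) simp
qed


section \<open>Counting points on affine quadrics\<close>

text \<open>The binary form takes the value 1 at some \<open>(k, l)\<close>, and the orthogonal
  vector \<open>(- \<beta> * l, \<alpha> * k)\<close> then has value
  \<open>\<alpha> * \<beta>\<close>. Passing to this basis diagonalises the form as
  \<open>(1, \<alpha> * \<beta>)\<close>.\<close>

lemma quadric_count_discriminant: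
  fixes \<alpha> \<beta> :: 'a
  assumes "\<alpha> \<noteq> 0" "\<beta> \<noteq> 0"
  shows "quadric_count \<alpha> \<beta> = quadric_count 1 (\<alpha> * \<beta>)"
proof -
  obtain k l where kl: "\<alpha> * k\<^sup>2 + \<beta> * l\<^sup>2 = 1"
    using binary_form_universal[OF assms] .
  let ?f = "\<lambda>(x, w, t). (k * x - \<beta> * l * w, l * x + \<alpha> * k * w, t)"
  \<comment> \<open>The change of basis has determinant
    \<open>\<alpha> * k\<^sup>2 + \<beta> * l\<^sup>2 = 1\<close>, so its adjugate is its
    inverse.\<close>
  let ?g = "\<lambda>(i, j, t). (\<alpha> * k * i + \<beta> * l * j, k * j - l * i, t)"
  have form: "\<alpha> * (k * x - \<beta> * l * w)\<^sup>2 + \<beta> * (l * x + \<alpha> * k * w)\<^sup>2 = x\<^sup>2 + \<alpha> * \<beta> * w\<^sup>2" for x w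
  proof -
    have "\<alpha> * (k * x - \<beta> * l * w)\<^sup>2 + \<beta> * (l * x + \<alpha> * k * w)\<^sup>2
      = (\<alpha> * k\<^sup>2 + \<beta> * l\<^sup>2) * (x\<^sup>2 + \<alpha> * \<beta> * w\<^sup>2)" by algebra
    then show ?thesis using kl by simp
  qed
  have gform: "(\<alpha> * k * i + \<beta> * l * j)\<^sup>2 + \<alpha> * \<beta> * (k * j - l * i)\<^sup>2 = \<alpha> * i\<^sup>2 + \<beta> * j\<^sup>2" for i j
  proof -
    have "(\<alpha> * k * i + \<beta> * l * j)\<^sup>2 + \<alpha> * \<beta> * (k * j - l * i)\<^sup>2
      = (\<alpha> * k\<^sup>2 + \<beta> * l\<^sup>2) * (\<alpha> * i\<^sup>2 + \<beta> * j\<^sup>2)" by algebra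
    then show ?thesis using kl by simp
  qed
  have gf: "\<alpha> * k * (k * x - \<beta> * l * w) + \<beta> * l * (l * x + \<alpha> * k * w) = x"
    "k * (l * x + \<alpha> * k * w) - l * (k * x - \<beta> * l * w) = w" for x w
    using kl by algebra+
  have fg: "k * (\<alpha> * k * i + \<beta> * l * j) - \<beta> * l * (k * j - l * i) = i"
    "l * (\<alpha> * k * i + \<beta> * l * j) + \<alpha> * k * (k * j - l * i) = j" for i j
    using kl by algebra+
  have "bij_betw ?f {(x, w, t). 1 * x\<^sup>2 + \<alpha> * \<beta> * w\<^sup>2 - t\<^sup>2 = 1 \<and> t \<noteq> 0}
     {(i, j, t). \<alpha> * i\<^sup>2 + \<beta> * j\<^sup>2 - t\<^sup>2 = 1 \<and> t \<noteq> 0}"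
    by (rule bij_betw_byWitness[where f' = ?g])
       (auto simp: gf fg form gform)
  from bij_betw_same_card[OF this] show ?thesis
    unfolding quadric_count_def by (rule sym)
qed

text \<open>Parametrise by \<open>r = x + t\<close>, so that \<open>x - t = c / r\<close>. The
  excluded value \<open>t = 0\<close> corresponds to \<open>r\<^sup>2 = c\<close>.\<close>

lemma card_hyperbola:
  fixes c :: 'a
  assumes "c \<noteq> 0"
  shows "card {(x::'a, t). x\<^sup>2 - t\<^sup>2 = c \<and> t \<noteq> 0} = card {r. r \<noteq> 0 \<and> r\<^sup>2 \<noteq> c}"
proof -
  have sq: "((r + c / r) / 2)\<^sup>2 - ((r - c / r) / 2)\<^sup>2 = c" if "r \<noteq> 0" for r
  proof -
    have "((r + c / r) / 2)\<^sup>2 - ((r - c / r) / 2)\<^sup>2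
      = ((r + c / r) / 2 + (r - c / r) / 2) * ((r + c / r) / 2 - (r - c / r) / 2)"
      by (simp only: square_diff_square_factored power2_eq_square)
    also have "(r + c / r) / 2 + (r - c / r) / 2 = r" using two by (simp add: field_simps)
    also have "(r + c / r) / 2 - (r - c / r) / 2 = c / r"
      using two that by (simp add: diff_divide_distrib[symmetric])
    finally show ?thesis using that by simp
  qed
  have inv: "x + t \<noteq> 0 \<and> c / (x + t) = x - t \<and> (x + t)\<^sup>2 \<noteq> c"
    if c: "x\<^sup>2 - t\<^sup>2 = c" and t: "t \<noteq> 0" for x t :: 'a
  proof -
    have p: "(x + t) * (x - t) = c" using c by (simp add: power2_eq_square algebra_simps)
    then have nz: "x + t \<noteq> 0" using assms by (metis mult_zero_left)
    moreover have "c / (x + t) = x - t"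
      unfolding p[symmetric] using nz by simp
    moreover have "(x + t)\<^sup>2 \<noteq> c"
    proof
      assume "(x + t)\<^sup>2 = c"
      then have "(x + t) * (2 * t) = 0"
        using c by (simp add: power2_eq_square algebra_simps)
      with t two nz show False by simp
    qed
    ultimately show ?thesis by blast
  qed
  have half: "(y + y) / 2 = y" for y :: 'a
    using two by (metis mult_2 nonzero_mult_div_cancel_left)
  have "bij_betw (\<lambda>(x, t). x + t) {(x, t). x\<^sup>2 - t\<^sup>2 = c \<and> t \<noteq> 0} {r. r \<noteq> 0 \<and> r\<^sup>2 \<noteq> c}"
  proof (rule bij_betw_byWitness[where f' = "\<lambda>r. ((r + c / r) / 2, (r - c / r) / 2)"])
    show "\<forall>a\<in>{(x, t). x\<^sup>2 - t\<^sup>2 = c \<and> t \<noteq> 0}.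
       (\<lambda>r. ((r + c / r) / 2, (r - c / r) / 2)) (case a of (x, t) \<Rightarrow> x + t) = a"
    proof
      fix a :: "'a \<times> 'a" assume "a \<in> {(x, t). x\<^sup>2 - t\<^sup>2 = c \<and> t \<noteq> 0}"
      then obtain x t where a: "a = (x, t)" and "x\<^sup>2 - t\<^sup>2 = c" "t \<noteq> 0" by blast
      note i = inv[OF this(2,3)]
      have "x + t + (x - t) = x + x" "x + t - (x - t) = t + t" by simp_all
      then show "(\<lambda>r. ((r + c / r) / 2, (r - c / r) / 2)) (case a of (x, t) \<Rightarrow> x + t) = a"
        using i half a by simp
    qed
    show "\<forall>r\<in>{r. r \<noteq> 0 \<and> r\<^sup>2 \<noteq> c}.
       (case ((r + c / r) / 2, (r - c / r) / 2) of (x, t) \<Rightarrow> x + t) = r"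
      using two by (simp add: add_divide_distrib[symmetric] half)
    show "(\<lambda>(x, t). x + t) ` {(x, t). x\<^sup>2 - t\<^sup>2 = c \<and> t \<noteq> 0} \<subseteq> {r. r \<noteq> 0 \<and> r\<^sup>2 \<noteq> c}"
      using inv by auto
    show "(\<lambda>r. ((r + c / r) / 2, (r - c / r) / 2)) ` {r. r \<noteq> 0 \<and> r\<^sup>2 \<noteq> c}
      \<subseteq> {(x, t). x\<^sup>2 - t\<^sup>2 = c \<and> t \<noteq> 0}"
    proof clarify
      fix r assume r: "r \<noteq> 0" "r\<^sup>2 \<noteq> c"
      then have "r - c / r \<noteq> 0" by (auto simp: field_simps power2_eq_square)
      then show "((r + c / r) / 2)\<^sup>2 - ((r - c / r) / 2)\<^sup>2 = c \<and> (r - c / r) / 2 \<noteq> 0"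
        using sq[OF r(1)] two by simp
    qed
  qed
  then show ?thesis by (rule bij_betw_same_card)
qed

lemma card_hyperbola_bounds:
  fixes c :: 'a
  assumes "c \<noteq> 0"
  shows "card {(x::'a, t). x\<^sup>2 - t\<^sup>2 = c \<and> t \<noteq> 0} \<le> CARD('a) - 1"
    and "CARD('a) - 3 \<le> card {(x::'a, t). x\<^sup>2 - t\<^sup>2 = c \<and> t \<noteq> 0}"
proof -
  have "card {r. r \<noteq> 0 \<and> r\<^sup>2 \<noteq> c} \<le> card (UNIV - {0::'a})" by (rule card_mono) auto
  then show "card {(x::'a, t). x\<^sup>2 - t\<^sup>2 = c \<and> t \<noteq> 0} \<le> CARD('a) - 1"
    unfolding card_hyperbola[OF assms] by (simp add: card_Diff_subset)
  obtain Z where Z: "{r::'a. r\<^sup>2 = c} \<subseteq> Z" "finite Z" "card Z \<le> 2"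
  proof (cases "\<exists>s. s\<^sup>2 = c")
    case True
    then obtain s where "s\<^sup>2 = c" by blast
    then show thesis by (intro that[of "{s, -s}"]) (auto simp: power2_eq_iff card_insert_if)
  next
    case False
    then show thesis by (intro that[of "{}"]) auto
  qed
  have "CARD('a) - card (insert 0 Z) = card (UNIV - insert 0 Z)"
    using Z by (simp add: card_Diff_subset)
  also have "\<dots> \<le> card {r. r \<noteq> 0 \<and> r\<^sup>2 \<noteq> c}" by (rule card_mono) (use Z in auto)
  finally show "CARD('a) - 3 \<le> card {(x::'a, t). x\<^sup>2 - t\<^sup>2 = c \<and> t \<noteq> 0}"
    unfolding card_hyperbola[OF assms] using Z card_insert_le_m1[of 3 Z 0] by simp
qed

text \<open>The quadric is cut into hyperbolas by fixing the second coordinate.\<close>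

lemma quadric_count_eq_sum:
  "quadric_count 1 \<Delta> = (\<Sum>w\<in>UNIV. card {(x::'a, t). x\<^sup>2 - t\<^sup>2 = 1 - \<Delta> * w\<^sup>2 \<and> t \<noteq> 0})"
proof -
  have "bij_betw (\<lambda>(x, w, t). (w, x, t)) {(i, j, t). 1 * i\<^sup>2 + \<Delta> * j\<^sup>2 - t\<^sup>2 = 1 \<and> t \<noteq> 0}
    (SIGMA w:UNIV. {(x::'a, t). x\<^sup>2 - t\<^sup>2 = 1 - \<Delta> * w\<^sup>2 \<and> t \<noteq> 0})"
    by (rule bij_betw_byWitness[where f' = "\<lambda>(w, x, t). (x, w, t)"]) (auto simp: algebra_simps)
  then show ?thesis
    unfolding quadric_count_def by (simp add: bij_betw_same_card card_SigmaI)
qed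

text \<open>For a non-square \<open>\<Delta>\<close> no slice degenerates, and each has at most q -
  1 points. For the square \<open>r\<^sup>2\<close> the two slices at \<open>1 / r\<close> and
  \<open>- (1 / r)\<close> degenerate and have 2 (q - 1) points, while the others have at least q -
  3. These bounds already separate the two counts, with a margin of 2.\<close>

lemma quadric_count_nonsquare_less_square:
  fixes \<Delta> r :: 'a
  assumes \<Delta>: "\<not> is_square \<Delta>" and r: "r \<noteq> 0"
  shows "quadric_count 1 \<Delta> < quadric_count 1 (r\<^sup>2)"
proof -
  let ?h = "\<lambda>c. card {(x::'a, t). x\<^sup>2 - t\<^sup>2 = c \<and> t \<noteq> 0}"
  have q3: "CARD('a) \<ge> 3"
  proof -
    have "card {0, 1, -1::'a} = 3" using neg_neq_self[OF two, of 1] by auto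
    then show ?thesis by (metis card_mono finite_class.finite_UNIV top_greatest)
  qed
  have "?h (1 - \<Delta> * w\<^sup>2) \<le> CARD('a) - 1" for w
  proof (rule card_hyperbola_bounds)
    show "1 - \<Delta> * w\<^sup>2 \<noteq> 0"
    proof
      assume "1 - \<Delta> * w\<^sup>2 = 0"
      then have "\<Delta> = (1 / w)\<^sup>2" by (cases "w = 0") (auto simp: field_simps)
      with \<Delta> show False by (auto simp: is_nth_power_def)
    qed
  qed
  then have upper: "quadric_count 1 \<Delta> \<le> CARD('a) * (CARD('a) - 1)"
    unfolding quadric_count_eq_sum using sum_bounded_above[of "UNIV :: 'a set" "\<lambda>w. ?h (1 - \<Delta> * w\<^sup>2)" "CARD('a) - 1"] by simp
  \<comment> \<open>A degenerate slice consists of the two lines \<open>x = t\<close> and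
    \<open>x = - t\<close> without their common point.\<close>
  have h0: "?h 0 = 2 * (CARD('a) - 1)"
  proof -
    have "{(x::'a, t). x\<^sup>2 - t\<^sup>2 = 0 \<and> t \<noteq> 0} = (\<lambda>t. (t, t)) ` (UNIV - {0}) \<union> (\<lambda>t. (- t, t)) ` (UNIV - {0})"
      by (auto simp: power2_eq_iff)
    moreover have "(\<lambda>t::'a. (t, t)) ` (UNIV - {0}) \<inter> (\<lambda>t. (- t, t)) ` (UNIV - {0}) = {}"
      using neg_neq_self[OF two] by fastforce
    moreover have "card ((\<lambda>t::'a. (t, t)) ` (UNIV - {0})) = CARD('a) - 1"
      "card ((\<lambda>t::'a. (- t, t)) ` (UNIV - {0})) = CARD('a) - 1"
      by (subst card_image; auto simp: inj_on_def card_Diff_subset)+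
    ultimately show ?thesis by (simp add: card_Un_disjoint)
  qed
  let ?Z = "{1 / r, - (1 / r)}"
  have cZ: "card ?Z = 2" using neg_neq_self[OF two, of "1 / r"] r by auto
  have hZ: "?h (1 - r\<^sup>2 * w\<^sup>2) = 2 * (CARD('a) - 1)" if "w \<in> ?Z" for w
  proof -
    have "1 - r\<^sup>2 * w\<^sup>2 = 0" using that r by (auto simp: power_divide)
    then show ?thesis using h0 by simp
  qed
  have hU: "CARD('a) - 3 \<le> ?h (1 - r\<^sup>2 * w\<^sup>2)" if "w \<in> UNIV - ?Z" for w
  proof (rule card_hyperbola_bounds(2))
    show "1 - r\<^sup>2 * w\<^sup>2 \<noteq> 0"
    proof
      assume "1 - r\<^sup>2 * w\<^sup>2 = 0"
      then have "(r * w)\<^sup>2 = 1" by (simp add: power_mult_distrib)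
      then have "r * w = 1 \<or> r * w = -1" by (simp add: power2_eq_1_iff)
      then have "w = 1 / r \<or> w = - (1 / r)" using r by (auto simp: field_simps)
      with that show False by auto
    qed
  qed
  have "CARD('a) * (CARD('a) - 1) < (CARD('a) - 2) * (CARD('a) - 3) + 2 * (2 * (CARD('a) - 1))"
  proof -
    \<comment> \<open>This substitution removes the truncated subtractions.\<close>
    obtain k where "CARD('a) = k + 3" using q3 by (metis le_add_diff_inverse2)
    then show ?thesis by (simp add: algebra_simps)
  qed
  also have "\<dots> \<le> (\<Sum>w\<in>UNIV - ?Z. ?h (1 - r\<^sup>2 * w\<^sup>2)) + (\<Sum>w\<in>?Z. ?h (1 - r\<^sup>2 * w\<^sup>2))"
  proof (rule add_mono)
    have "card (UNIV - ?Z) = CARD('a) - 2"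
      using cZ by (simp add: card_Diff_subset)
    then show "(CARD('a) - 2) * (CARD('a) - 3) \<le> (\<Sum>w\<in>UNIV - ?Z. ?h (1 - r\<^sup>2 * w\<^sup>2))"
      using sum_bounded_below[of "UNIV - ?Z" "CARD('a) - 3" "\<lambda>w. ?h (1 - r\<^sup>2 * w\<^sup>2)", OF hU]
      by simp
    have "(\<Sum>w\<in>?Z. ?h (1 - r\<^sup>2 * w\<^sup>2)) = (\<Sum>w\<in>?Z. 2 * (CARD('a) - 1))"
      by (rule sum.cong[OF refl hZ])
    also have "\<dots> = card ?Z * (2 * (CARD('a) - 1))"
      by (simp only: sum_constant of_nat_id)
    finally show "2 * (2 * (CARD('a) - 1)) \<le> (\<Sum>w\<in>?Z. ?h (1 - r\<^sup>2 * w\<^sup>2))"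
      unfolding cZ by simp
  qed
  also have "\<dots> = quadric_count 1 (r\<^sup>2)"
    unfolding quadric_count_eq_sum by (rule sum.subset_diff[symmetric]) auto
  finally show ?thesis using upper by simp
qed

text \<open>Only the discriminants matter. They differ by the factor \<open>g\<close>, so exactly
  one of them is a square.\<close>

lemma quadric_count_neq:
  fixes \<alpha> \<beta> g :: 'a
  assumes "\<alpha> \<noteq> 0" "\<beta> \<noteq> 0" "\<not> is_square g"
  shows "quadric_count (\<alpha> * g) \<beta> \<noteq> quadric_count \<alpha> \<beta>"
proof -
  have g: "g \<noteq> 0" using assms by auto
  have eq: "quadric_count (\<alpha> * g) \<beta> = quadric_count 1 (g * (\<alpha> * \<beta>))"
    using quadric_count_discriminant[of "\<alpha> * g" \<beta>] assms g by (simp add: mult_ac)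
  show ?thesis
  proof (cases "is_square (\<alpha> * \<beta>)")
    case True
    then obtain r where r: "\<alpha> * \<beta> = r\<^sup>2" by (auto simp: is_nth_power_def)
    then have r0: "r \<noteq> 0" using assms by auto
    have "\<not> is_square (g * (\<alpha> * \<beta>))"
    proof
      assume "is_square (g * (\<alpha> * \<beta>))"
      then obtain s where "g * r\<^sup>2 = s\<^sup>2" unfolding r by (auto simp: is_nth_power_def)
      then have "g = (s / r)\<^sup>2" using r0 by (simp add: field_simps)
      with assms(3) show False by (auto simp: is_nth_power_def)
    qed
    from quadric_count_nonsquare_less_square[OF this r0] show ?thesis
      unfolding eq r[symmetric] quadric_count_discriminant[OF assms(1,2)] by simp
  next
    case False
    from nonsquare_mult_nonsquare[OF assms(3) False]
    obtain r where r: "g * (\<alpha> * \<beta>) = r\<^sup>2" by (auto simp: is_nth_power_def)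
    then have r0: "r \<noteq> 0" using assms g by auto
    from quadric_count_nonsquare_less_square[OF False r0] show ?thesis
      unfolding eq r[symmetric] quadric_count_discriminant[OF assms(1,2)] by simp
  qed
qed

end

subsection \<open>Quadratic spaces\<close>

locale quadratic_space =
  fixes \<sigma> :: "'a::{field,finite} ^ 'n \<Rightarrow> 'a"
  assumes form: "quadratic_form \<sigma>"
    and nondeg: "nondegenerate \<sigma>"
    and two: "(2::'a) \<noteq> 0"
begin

definition b :: "'a ^ 'n \<Rightarrow> 'a ^ 'n \<Rightarrow> 'a" where
  "b u v = polar \<sigma> u v / 2"

lemma b_add_left [simp]: "b (u + v) w = b u w + b v w"
  using form unfolding quadratic_form_def b_def
  by (auto simp: Vector_Spaces.linear_iff add_divide_distrib)

lemma b_add_right [simp]: "b w (u + v) = b w u + b w v"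
  using form unfolding quadratic_form_def b_def
  by (auto simp: Vector_Spaces.linear_iff add_divide_distrib)

lemma b_scale_left [simp]: "b (c *s u) w = c * b u w"
  using form unfolding quadratic_form_def b_def
  by (auto simp: Vector_Spaces.linear_iff)

lemma b_scale_right [simp]: "b w (c *s u) = c * b w u"
  using form unfolding quadratic_form_def b_def
  by (auto simp: Vector_Spaces.linear_iff)

lemma b_commute: "b u v = b v u"
  by (simp add: b_def polar_def add.commute)

lemma b_zero_left [simp]: "b 0 w = 0"
  using b_scale_left[of 0 0 w] by simp

lemma b_zero_right [simp]: "b w 0 = 0"
  using b_scale_right[of w 0 0] by simp

lemma b_minus_left [simp]: "b (- u) w = - b u w"
  using b_scale_left[of "-1" u w] by simp

lemma b_minus_right [simp]: "b w (- u) = - b w u"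
  using b_scale_right[of w "-1" u] by simp

lemma b_diff_left [simp]: "b (u - v) w = b u w - b v w"
  using b_add_left[of u "- v" w] by simp

lemma b_diff_right [simp]: "b w (u - v) = b w u - b w v"
  using b_add_right[of w u "- v"] by simp

lemma b_self: "b v v = \<sigma> v"
proof -
  have "v + v = 2 *s v" by (simp add: vec_eq_iff)
  then have "\<sigma> (v + v) = 2\<^sup>2 * \<sigma> v"
    using form unfolding quadratic_form_def by metis
  then have "polar \<sigma> v v = 2 * \<sigma> v"
    by (simp add: polar_def)
  then show ?thesis using two by (simp add: b_def)
qed

lemma mem_perp_iff: "v \<in> perp \<sigma> S \<longleftrightarrow> (\<forall>s\<in>S. b v s = 0)"
  using two by (simp add: perp_def b_def)

lemma b_nondegenerate:
  assumes "\<And>y. b x y = 0"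
  shows "x = 0"
  using nondeg assms mem_perp_iff[of x UNIV] unfolding nondegenerate_def by simp

definition nondeg_on :: "('a ^ 'n) set \<Rightarrow> bool" where
  "nondeg_on S \<longleftrightarrow> vec.subspace S \<and> (\<forall>x\<in>S. (\<forall>y\<in>S. b x y = 0) \<longrightarrow> x = 0)"

definition orth :: "'a ^ 'n \<Rightarrow> ('a ^ 'n) set" where
  "orth v = {x. b x v = 0}"

lemma subspace_orth: "vec.subspace (orth v)"
  by (rule vec.subspaceI) (auto simp: orth_def)

lemma nondeg_on_UNIV: "nondeg_on UNIV"
  unfolding nondeg_on_def using b_nondegenerate by auto

text \<open>Subtracting the projection to \<open>v\<close> shows that \<open>S\<close> is the
  orthogonal sum of the line of \<open>v\<close> and \<open>S \<inter> orth v\<close>. A vector of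
  the second summand that is perpendicular to that summand is therefore perpendicular to all of
  \<open>S\<close>.\<close>

lemma nondeg_on_orth:
  assumes S: "nondeg_on S" and v: "v \<in> S" "b v v \<noteq> 0"
  shows "nondeg_on (S \<inter> orth v)" and "vec.dim S = Suc (vec.dim (S \<inter> orth v))"
proof -
  have sub: "vec.subspace S" using S by (simp add: nondeg_on_def)
  have sub': "vec.subspace (S \<inter> orth v)"
    using vec.subspace_inter[OF sub subspace_orth] .
  have proj: "x - (b x v / b v v) *s v \<in> S \<inter> orth v" if "x \<in> S" for x
    using that v sub by (auto simp: orth_def vec.subspace_diff vec.subspace_scale)
  show "nondeg_on (S \<inter> orth v)"
    unfolding nondeg_on_def
  proof (intro conjI ballI impI)
    fix x assume x: "x \<in> S \<inter> orth v" "\<forall>y\<in>S \<inter> orth v. b x y = 0"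
    have "b x y = 0" if "y \<in> S" for y
    proof -
      have "b x (y - (b y v / b v v) *s v) = 0" using x(2) proj[OF that] by blast
      then show ?thesis using x(1) by (simp add: orth_def)
    qed
    then show "x = 0" using S x(1) by (auto simp: nondeg_on_def)
  qed (fact sub')
  have "v \<notin> vec.span (S \<inter> orth v)"
    using v(2) sub' by (simp add: vec.span_eq_iff[THEN iffD2] orth_def)
  then have "vec.dim (insert v (S \<inter> orth v)) = Suc (vec.dim (S \<inter> orth v))"
    by (simp add: vec.dim_insert)
  moreover have "vec.span (insert v (S \<inter> orth v)) = S"
  proof
    show "vec.span (insert v (S \<inter> orth v)) \<subseteq> S"
      by (rule vec.span_minimal) (use v sub in auto)
    show "S \<subseteq> vec.span (insert v (S \<inter> orth v))"
    proof
      fix x assume "x \<in> S"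
      then have "x - (b x v / b v v) *s v \<in> vec.span (S \<inter> orth v)"
        by (intro vec.span_base proj)
      then show "x \<in> vec.span (insert v (S \<inter> orth v))"
        by (auto simp: vec.span_insert)
    qed
  qed
  ultimately show "vec.dim S = Suc (vec.dim (S \<inter> orth v))"
    by (metis vec.dim_span)
qed

text \<open>By polarisation, a form vanishing on all of \<open>S\<close> has \<open>b = 0\<close> on
  \<open>S\<close>, which leaves only the zero space.\<close>

lemma nondeg_on_nonsingular:
  assumes S: "nondeg_on S" and d: "vec.dim S \<ge> 1"
  obtains v where "v \<in> S" "b v v \<noteq> 0"
proof -
  have "\<exists>v\<in>S. b v v \<noteq> 0"
  proof (rule ccontr)
    assume "\<not> ?thesis"
    then have iso: "\<And>v. v \<in> S \<Longrightarrow> b v v = 0" by blast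
    have "b x y = 0" if "x \<in> S" "y \<in> S" for x y
    proof -
      have "x + y \<in> S" using that S by (simp add: nondeg_on_def vec.subspace_add)
      from iso[OF this] iso that have "2 * b x y = 0" by (simp add: b_commute[of y x])
      then show ?thesis using two by simp
    qed
    then have "S \<subseteq> {0}" using S by (auto simp: nondeg_on_def)
    then have "vec.dim S = 0" by (simp add: vec.dim_eq_0)
    with d show False by simp
  qed
  with that show thesis by blast
qed

text \<open>Two orthogonal nonsingular vectors span a binary diagonal form, and such a form takes
  every value.\<close>

lemma nondeg_on_represents:
  assumes S: "nondeg_on S" and d: "vec.dim S \<ge> 2"
  obtains v where "v \<in> S" "b v v = c"
proof -
  obtain x where x: "x \<in> S" "b x x \<noteq> 0" using nondeg_on_nonsingular[OF S] d by auto
  have "vec.dim (S \<inter> orth x) \<ge> 1" using nondeg_on_orth(2)[OF S x] d by simp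
  then obtain y where y: "y \<in> S \<inter> orth x" "b y y \<noteq> 0"
    using nondeg_on_nonsingular[OF nondeg_on_orth(1)[OF S x]] by auto
  obtain i j where ij: "b x x * i\<^sup>2 + b y y * j\<^sup>2 = c"
    using binary_form_universal[OF two x(2) y(2)] .
  have yx: "b y x = 0" "b x y = 0" using y(1) b_commute[of x y] by (auto simp: orth_def)
  show thesis
  proof
    show "i *s x + j *s y \<in> S"
      using x y S by (auto simp: nondeg_on_def intro: vec.subspace_add vec.subspace_scale)
    show "b (i *s x + j *s y) (i *s x + j *s y) = c"
      using ij yx by (simp add: power2_eq_square mult_ac)
  qed
qed

text \<open>As long as the dimension is at least two, a vector of value \<open>e\<close> exists and
  can be split off. The last line need not contain one, so its generator \<open>s\<close> is kept
  with an unspecified nonzero value.\<close>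

lemma nondeg_on_orthonormal_list:
  assumes "nondeg_on S" "vec.dim S = Suc k" "e \<noteq> 0"
  shows "\<exists>ys s. length ys = k \<and> set ys \<subseteq> S \<and> s \<in> S \<and> b s s \<noteq> 0 \<and>
    (\<forall>y\<in>set ys. b y y = e \<and> b s y = 0) \<and> sorted_wrt (\<lambda>x y. b x y = 0) ys \<and>
    (\<forall>u\<in>S. (\<forall>y\<in>set ys. b u y = 0) \<longrightarrow> (\<exists>j. u = j *s s))"
  using assms
proof (induction k arbitrary: S)
  case 0
  obtain s where s: "s \<in> S" "b s s \<noteq> 0" using nondeg_on_nonsingular[OF 0(1)] 0(2) by auto
  have "vec.dim (S \<inter> orth s) = 0" using nondeg_on_orth(2)[OF 0(1) s] 0(2) by simp
  then have z: "S \<inter> orth s \<subseteq> {0}" by (simp add: vec.dim_eq_0)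
  have "\<exists>j. u = j *s s" if "u \<in> S" for u
  proof -
    have "u - (b u s / b s s) *s s \<in> S \<inter> orth s"
      using that s 0(1) by (auto simp: nondeg_on_def orth_def vec.subspace_diff vec.subspace_scale)
    then have "u = (b u s / b s s) *s s" using z by auto
    then show ?thesis by blast
  qed
  with s show ?case by auto
next
  case (Suc k)
  obtain y where y: "y \<in> S" "b y y = e" using nondeg_on_represents[OF Suc.prems(1)] Suc.prems(2) by auto
  have y0: "b y y \<noteq> 0" using y Suc.prems by simp
  have "vec.dim (S \<inter> orth y) = Suc k" using nondeg_on_orth(2)[OF Suc.prems(1) y(1) y0] Suc.prems(2) by simp
  from Suc.IH[OF nondeg_on_orth(1)[OF Suc.prems(1) y(1) y0] this Suc.prems(3)]
  obtain ys s where *: "length ys = k" "set ys \<subseteq> S \<inter> orth y" "s \<in> S \<inter> orth y" "b s s \<noteq> 0"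
    "\<forall>y\<in>set ys. b y y = e \<and> b s y = 0" "sorted_wrt (\<lambda>x y. b x y = 0) ys"
    "\<forall>u\<in>S \<inter> orth y. (\<forall>y\<in>set ys. b u y = 0) \<longrightarrow> (\<exists>j. u = j *s s)" by blast
  have "b y x = 0" if "x \<in> set ys" for x
    using that *(2) b_commute[of y x] by (auto simp: orth_def)
  then show ?case
    using * y by (intro exI[of _ "y # ys"] exI[of _ s]) (auto simp: orth_def)
qed

section \<open>Reflections and transitivity on orthogonal lists\<close>

text \<open>The reflection in \<open>x - y\<close> sends \<open>x\<close> to \<open>y\<close>, and
  the one in \<open>x + y\<close> sends \<open>x\<close> to \<open>- y\<close>. One of the two
  vectors is nonsingular; since it is not known which, the sign stays open.\<close>

lemma isometry_swap:
  assumes x: "b x x = e" and y: "b y y = e" and e: "e \<noteq> 0"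
  obtains g where "\<And>u v. b (g u) (g v) = b u v" "g x = y \<or> g x = - y"
    "\<And>t. b t x = 0 \<Longrightarrow> b t y = 0 \<Longrightarrow> g t = t"
    "\<And>u v. g (u + v) = g u + g v" "\<And>c u. g (c *s u) = c *s g u"
proof -
  define refl where "refl = (\<lambda>r u. u - (2 * b u r / b r r) *s r)"
  have iso: "b (refl r u) (refl r v) = b u v" if "b r r \<noteq> 0" for r u v
    using that unfolding refl_def by (simp add: b_commute[of r v] field_simps)
  have add: "refl r (u + v) = refl r u + refl r v" and scale: "refl r (c *s u) = c *s refl r u" for r u v c
    by (simp_all add: refl_def vec_eq_iff algebra_simps add_divide_distrib)
  have fx: "refl r t = t" if "b t r = 0" for r t using that by (simp add: refl_def)
  \<comment> \<open>The parallelogram law gives \<open>4 * e\<close>, which is nonzero, so the two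
    values cannot both vanish.\<close>
  have "b (x - y) (x - y) + b (x + y) (x + y) = 2 * 2 * e"
    using x y by simp
  then consider "b (x - y) (x - y) \<noteq> 0" | "b (x + y) (x + y) \<noteq> 0"
    using e two by (metis add.right_neutral mult_eq_0_iff)
  then show thesis
  proof cases
    case 1
    have "2 * b x (x - y) = b (x - y) (x - y)" using x y by (simp add: b_commute[of y x])
    then have "refl (x - y) x = y" using 1 by (simp add: refl_def del: b_diff_left b_diff_right)
    then show thesis
      by (intro that[of "refl (x - y)"]) (auto simp: iso[OF 1] add scale intro: fx)
  next
    case 2
    have "2 * b x (x + y) = b (x + y) (x + y)" using x y by (simp add: b_commute[of y x])
    then have "refl (x + y) x = - y" using 2 by (simp add: refl_def del: b_add_left b_add_right)
    then show thesis
      by (intro that[of "refl (x + y)"]) (auto simp: iso[OF 2] add scale intro: fx)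
  qed
qed

text \<open>A case of Witt's theorem. After the tails are matched, the swap for the heads fixes the
  images of the tail vectors, since these are perpendicular to both vectors being swapped.\<close>

lemma isometry_lists:
  assumes "length us = length vs" "e \<noteq> 0"
    "sorted_wrt (\<lambda>x y. b x y = 0) us" "\<forall>u\<in>set us. b u u = e"
    "sorted_wrt (\<lambda>x y. b x y = 0) vs" "\<forall>v\<in>set vs. b v v = e"
  shows "\<exists>g. (\<forall>u v. b (g u) (g v) = b u v) \<and> list_all2 (\<lambda>u v. g u = v \<or> g u = - v) us vs"
  using assms
proof (induction us vs rule: list_induct2)
  case Nil
  then show ?case by (auto intro!: exI[of _ id])
next
  case (Cons u us v vs)
  then obtain g where g: "\<And>u v. b (g u) (g v) = b u v"
    "list_all2 (\<lambda>u v. g u = v \<or> g u = - v) us vs" by auto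
  have "b (g u) (g u) = e" "b v v = e" using g(1) Cons.prems by auto
  from isometry_swap[OF this Cons.prems(1)] obtain h where
    h: "\<And>u v. b (h u) (h v) = b u v" "h (g u) = v \<or> h (g u) = - v"
    "\<And>t. b t (g u) = 0 \<Longrightarrow> b t v = 0 \<Longrightarrow> h t = t" by metis
  have "list_all2 (\<lambda>u v. h (g u) = v \<or> h (g u) = - v) us vs"
  proof (rule list_all2_all_nthI)
    show "length us = length vs" using Cons.hyps .
    fix i assume i: "i < length us"
    have gi: "g (us ! i) = vs ! i \<or> g (us ! i) = - vs ! i"
      using list_all2_nthD[OF g(2) i] .
    have "us ! i \<in> set us" "vs ! i \<in> set vs" using i Cons.hyps by auto
    then have "b u (us ! i) = 0" "b v (vs ! i) = 0" using Cons.prems by auto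
    then have "b (g (us ! i)) (g u) = 0" "b (g (us ! i)) v = 0"
      using g(1) gi by (auto simp: b_commute[of _ u] b_commute[of _ v])
    from h(3)[OF this] gi show "h (g (us ! i)) = vs ! i \<or> h (g (us ! i)) = - vs ! i" by simp
  qed
  then show ?case
    using g h(1,2) by (intro exI[of _ "h \<circ> g"]) auto
qed

text \<open>Works with vectors instead of points: for \<open>e \<noteq> 0\<close> each common
  neighbour is represented by exactly two vectors of value \<open>e\<close>.\<close>

definition common_perp :: "'a \<Rightarrow> ('a ^ 'n) set \<Rightarrow> ('a ^ 'n) set" where
  "common_perp e K = {u. b u u = e \<and> (\<forall>k\<in>K. b u k = 0)}"

lemma card_common_perp_eq:
  assumes "length us = length vs" "e \<noteq> 0"
    "sorted_wrt (\<lambda>x y. b x y = 0) us" "\<forall>u\<in>set us. b u u = e"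
    "sorted_wrt (\<lambda>x y. b x y = 0) vs" "\<forall>v\<in>set vs. b v v = e"
  shows "card (common_perp e (set us)) = card (common_perp e (set vs))"
proof -
  \<comment> \<open>An isometry is injective by nondegeneracy and carries one set into the other,
    the signs being irrelevant for perpendicularity. Equality follows by exchanging the two
    lists.\<close>
  have le: "card (common_perp e (set us)) \<le> card (common_perp e (set vs))"
    if all: "list_all2 (\<lambda>u v. g u = v \<or> g u = - v) us vs" and iso: "\<forall>u v. b (g u) (g v) = b u v"
    for us vs g
  proof (rule card_inj_on_le[where f = g])
    have "x = y" if "g x = g y" for x y
    proof -
      have "b (x - y) w = 0" for w
        using iso[rule_format, of x w] iso[rule_format, of y w] that by simp
      then have "x - y = 0" by (rule b_nondegenerate)
      then show ?thesis by simp
    qed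
    then show "inj_on g (common_perp e (set us))" by (rule inj_onI)
    show "g ` common_perp e (set us) \<subseteq> common_perp e (set vs)"
    proof (rule image_subsetI)
      fix x assume x: "x \<in> common_perp e (set us)"
      have "b (g x) v = 0" if v: "v \<in> set vs" for v
      proof -
        obtain i where i: "i < length vs" "vs ! i = v" using v unfolding in_set_conv_nth by (elim exE conjE)
        have "us ! i \<in> set us" using i list_all2_lengthD[OF all] by simp
        then have "b (g x) (g (us ! i)) = 0" using x iso[rule_format, of x "us ! i"] by (simp add: common_perp_def)
        moreover have "g (us ! i) = v \<or> g (us ! i) = - v"
          using list_all2_nthD2[OF all i(1)] i(2) by simp
        ultimately show ?thesis by auto
      qed
      then show "g x \<in> common_perp e (set vs)"
        using x iso[rule_format, of x x] by (simp add: common_perp_def)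
    qed
  qed simp
  from isometry_lists[OF assms] have "card (common_perp e (set us)) \<le> card (common_perp e (set vs))"
    by (elim exE conjE) (rule le)
  moreover from isometry_lists[OF assms(1)[symmetric] assms(2,5,6,3,4)]
  have "card (common_perp e (set vs)) \<le> card (common_perp e (set us))"
    by (elim exE conjE) (rule le)
  ultimately show ?thesis by (rule le_antisym)
qed

section \<open>Points and the vectors spanning them\<close>

definition pt :: "'a ^ 'n \<Rightarrow> ('a ^ 'n) set" where "pt v = vec.span {v}"

lemma pt_eq: "pt v = range (\<lambda>c. c *s v)"
  by (simp add: pt_def vec.span_singleton)

lemma mem_pt: "v \<in> pt v"
  by (simp add: pt_def vec.span_base)

lemma subspace_pt: "vec.subspace (pt v)"
  by (simp add: pt_def)

lemma pt_subset_subspace: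
  assumes "vec.subspace S"
  shows "pt v \<subseteq> S \<longleftrightarrow> v \<in> S"
proof
  assume "v \<in> S"
  then show "pt v \<subseteq> S" unfolding pt_def by (intro vec.span_minimal assms) simp
qed (use mem_pt in blast)

lemma pt_scale:
  assumes c: "c \<noteq> 0"
  shows "pt (c *s v) = pt v"
proof
  show "pt (c *s v) \<subseteq> pt v"
    unfolding pt_subset_subspace[OF subspace_pt]
    by (rule vec.subspace_scale[OF subspace_pt mem_pt])
  have "(1 / c) *s (c *s v) \<in> pt (c *s v)"
    by (rule vec.subspace_scale[OF subspace_pt mem_pt])
  then show "pt v \<subseteq> pt (c *s v)"
    unfolding pt_subset_subspace[OF subspace_pt] using c by simp
qed

lemma pt_subset_perp: "pt u \<subseteq> perp \<sigma> (pt v) \<longleftrightarrow> b u v = 0"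
proof
  assume "pt u \<subseteq> perp \<sigma> (pt v)"
  then have "u \<in> perp \<sigma> (pt v)" using mem_pt by blast
  then show "b u v = 0" unfolding mem_perp_iff using mem_pt by blast
qed (auto simp: pt_eq mem_perp_iff)

lemma pt_eqD:
  assumes "pt u = pt v"
  obtains c where "u = c *s v"
proof -
  have "u \<in> pt v" using mem_pt assms by blast
  then show thesis unfolding pt_eq using that by blast
qed

lemma pt_eq_iff:
  assumes "b u u = e" "b v v = e" "e \<noteq> 0"
  shows "pt u = pt v \<longleftrightarrow> v = u \<or> v = - u"
proof
  assume "pt u = pt v"
  then obtain c where c: "v = c *s u" using pt_eqD[of v u] by metis
  then have "c * (c * e) = e" using assms by simp
  then have "c\<^sup>2 = 1" using assms(3) by (simp add: power2_eq_square flip: mult.assoc)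
  then have "c = 1 \<or> c = -1" by (simp add: power2_eq_1_iff)
  then show "v = u \<or> v = - u" using c by auto
next
  assume "v = u \<or> v = - u"
  then show "pt u = pt v" using pt_scale[of "-1" u] by auto
qed

lemma card_pt_image:
  assumes e: "e \<noteq> 0" and X: "\<And>x. x \<in> X \<Longrightarrow> b x x = e \<and> - x \<in> X"
  shows "card X = 2 * card (pt ` X)"
proof (rule card_image_two_to_one)
  fix x assume x: "x \<in> X"
  have "- x \<noteq> x"
  proof
    assume "- x = x"
    then have "2 * b x x = 0" by (metis add.right_inverse b_minus_left mult_2)
    with X[OF x] e two show False by simp
  qed
  with X[OF x] show "- x \<in> X \<and> - x \<noteq> x" by simp
next
  fix x y assume "x \<in> X" "y \<in> X"
  then show "pt x = pt y \<longleftrightarrow> y = x \<or> y = - x"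
    using X e by (intro pt_eq_iff) auto
qed simp

end

subsection \<open>Points of a given sign\<close>

text \<open>The class of scalars that defines \<open>V\<^sub>\<epsilon>\<close>. Zero is excluded in
  both cases, because 0 is a square.\<close>

definition of_sign :: "sign \<Rightarrow> 'a::field \<Rightarrow> bool" where
  "of_sign \<epsilon> c \<longleftrightarrow> (case \<epsilon> of Pos \<Rightarrow> c \<noteq> 0 \<and> is_square c | Neg \<Rightarrow> \<not> is_square c)"

lemma is_square_scale_iff:
  fixes x t :: "'a::field"
  assumes "t \<noteq> 0"
  shows "is_square (t\<^sup>2 * x) \<longleftrightarrow> is_square x"
proof
  assume "is_square x"
  then obtain y where "x = y\<^sup>2" by (auto simp: is_nth_power_def)
  then have "t\<^sup>2 * x = (t * y)\<^sup>2" by (simp add: power_mult_distrib)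
  then show "is_square (t\<^sup>2 * x)" unfolding is_nth_power_def by blast
next
  assume "is_square (t\<^sup>2 * x)"
  then obtain y where "t\<^sup>2 * x = y\<^sup>2" by (auto simp: is_nth_power_def)
  then have "x = (y / t)\<^sup>2" using assms by (simp add: field_simps)
  then show "is_square x" unfolding is_nth_power_def by blast
qed

lemma of_sign_scale: "t \<noteq> 0 \<Longrightarrow> of_sign \<epsilon> (t\<^sup>2 * x) \<longleftrightarrow> of_sign \<epsilon> (x::'a::field)"
  by (cases \<epsilon>) (auto simp: of_sign_def is_square_scale_iff)

lemma of_sign_nonzero: "of_sign \<epsilon> x \<Longrightarrow> x \<noteq> 0"
  by (cases \<epsilon>) (auto simp: of_sign_def)

text \<open>Up to the square \<open>y\<^sup>2\<close>, the quotient is the product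
  \<open>x * y\<close>, which is a square both for two squares and for two non-squares.\<close>

lemma of_sign_ratio:
  fixes x y :: "'a::{field,finite}"
  assumes two: "(2::'a) \<noteq> 0" and xy: "of_sign \<epsilon> x" "of_sign \<epsilon> y"
  obtains t where "t \<noteq> 0" "x = t\<^sup>2 * y"
proof -
  have nz: "x \<noteq> 0" "y \<noteq> 0" using xy of_sign_nonzero by blast+
  have "is_square (y\<^sup>2 * (x / y))"
  proof (cases \<epsilon>)
    case Pos
    then obtain r s where "x = r\<^sup>2" "y = s\<^sup>2" using xy by (auto simp: of_sign_def is_nth_power_def)
    then have "y\<^sup>2 * (x / y) = (r * s)\<^sup>2" using nz by (simp add: power2_eq_square)
    then show ?thesis unfolding is_nth_power_def by blast
  next
    case Neg
    then have "is_square (x * y)" using xy by (intro nonsquare_mult_nonsquare[OF two]) (auto simp: of_sign_def)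
    moreover have "y\<^sup>2 * (x / y) = x * y" using nz by (simp add: power2_eq_square)
    ultimately show ?thesis by simp
  qed
  then have "is_square (x / y)" using is_square_scale_iff[OF nz(2)] by blast
  then obtain t where t: "x / y = t\<^sup>2" unfolding is_nth_power_def by blast
  show thesis
  proof
    show "t \<noteq> 0" using t nz by auto
    show "x = t\<^sup>2 * y" using t nz by (simp add: field_simps)
  qed
qed

context quadratic_space
begin

lemma points_of_sign_eq_image: "points_of_sign \<sigma> \<epsilon> = pt ` {v. of_sign \<epsilon> (b v v)}"
  by (cases \<epsilon>) (auto simp: points_of_sign_def of_sign_def is_nth_power_def pt_def b_self)

text \<open>Values of the same sign differ by a square factor, so rescaling gives every vertex a
  spanning vector of the one value \<open>e\<close>. From here on the graph is described by a single
  level set.\<close>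

lemma points_of_sign_eq_level_set:
  assumes w: "pt w \<in> points_of_sign \<sigma> \<epsilon>" and e: "b w w = e"
  shows "e \<noteq> 0" and "points_of_sign \<sigma> \<epsilon> = pt ` {v. b v v = e}"
proof -
  obtain v where v: "pt w = pt v" "of_sign \<epsilon> (b v v)"
    using w unfolding points_of_sign_eq_image by blast
  obtain c where c: "w = c *s v" using pt_eqD[OF v(1)] .
  obtain c' where c': "v = c' *s w" using pt_eqD[OF v(1)[symmetric]] .
  have "c \<noteq> 0"
  proof
    assume "c = 0"
    then have "b v v = 0" using c c' by simp
    with of_sign_nonzero[OF v(2)] show False by simp
  qed
  moreover have "e = c\<^sup>2 * b v v" using e c by (auto simp: power2_eq_square)
  ultimately have s: "of_sign \<epsilon> e" using v(2) of_sign_scale by blast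
  then show "e \<noteq> 0" by (rule of_sign_nonzero)
  show "points_of_sign \<sigma> \<epsilon> = pt ` {v. b v v = e}"
    unfolding points_of_sign_eq_image
  proof (intro equalityI image_subsetI)
    fix u assume "u \<in> {v. of_sign \<epsilon> (b v v)}"
    then obtain t where t: "t \<noteq> 0" "b u u = t\<^sup>2 * e" using of_sign_ratio[OF two _ s] by blast
    have "b ((1 / t) *s u) ((1 / t) *s u) = e" using t by (simp add: power2_eq_square)
    moreover have "pt u = pt ((1 / t) *s u)" using pt_scale[of "1 / t" u] t by simp
    ultimately show "pt u \<in> pt ` {v. b v v = e}" by blast
  qed (use s in auto)
qed

end

subsection \<open>The switching set\<close>

text \<open>The configuration after normalisation: the given subspaces are \<open>p\<close> extended
  by \<open>v\<^sub>1\<close> and by \<open>v\<^sub>2\<close>, with \<open>p\<close> in the radical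
  of both and both vectors scaled to the value \<open>e\<close>.\<close>

locale tangent_pair = quadratic_space \<sigma>
  for \<sigma> :: "'a::{field,finite} ^ 'n \<Rightarrow> 'a" +
  fixes e :: 'a and v\<^sub>1 v\<^sub>2 :: "'a ^ 'n" and p :: "('a ^ 'n) set"
  assumes e: "e \<noteq> 0"
    and sub: "vec.subspace p"
    and pp: "\<And>w w'. w \<in> p \<Longrightarrow> w' \<in> p \<Longrightarrow> b w w' = 0"
    and pv: "\<And>w. w \<in> p \<Longrightarrow> b w v\<^sub>1 = 0" "\<And>w. w \<in> p \<Longrightarrow> b w v\<^sub>2 = 0"
    and vv: "b v\<^sub>1 v\<^sub>1 = e" "b v\<^sub>2 v\<^sub>2 = e"
    and disj: "(\<lambda>w. pt (v\<^sub>1 + w)) ` p \<inter> (\<lambda>w. pt (v\<^sub>2 + w)) ` p = {}"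
begin

abbreviation C :: "'a ^ 'n \<Rightarrow> ('a ^ 'n) set set" where
  "C v \<equiv> (\<lambda>w. pt (v + w)) ` p"

abbreviation G :: "('a ^ 'n) set graph" where
  "G \<equiv> \<lparr>verts = pt ` {v. b v v = e}, adj = (\<lambda>x y. x \<subseteq> perp \<sigma> y)\<rparr>"

text \<open>Lets facts that hold for both \<open>v\<^sub>1\<close> and \<open>v\<^sub>2\<close> be
  stated once.\<close>

definition reps :: "('a ^ 'n) set" where "reps = {v\<^sub>1, v\<^sub>2}"

lemma b_reps [simp]:
  assumes "v \<in> reps" "w \<in> p"
  shows "b w v = 0" "b v w = 0"
  using assms pv b_commute[of v w] by (auto simp: reps_def)

declare pp [simp]

lemma reps_self: "v \<in> reps \<Longrightarrow> b v v = e"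
  using vv by (auto simp: reps_def)

lemma C_subset_verts: "v \<in> reps \<Longrightarrow> C v \<subseteq> verts G"
  by (auto simp: reps_self)

text \<open>Of the two spanning vectors of value \<open>e\<close> only one lies in the coset of
  \<open>v\<close>: pairing \<open>v + w' = - (v + w)\<close> with \<open>v + w\<close> would give
  \<open>e = - e\<close>.\<close>

lemma inj_on_coset_pt:
  assumes v: "v \<in> reps"
  shows "inj_on (\<lambda>w. pt (v + w)) p"
proof (rule inj_onI)
  fix w w' assume w: "w \<in> p" "w' \<in> p" and eq: "pt (v + w) = pt (v + w')"
  have "v + w' = v + w \<or> v + w' = - (v + w)"
    using eq w v e by (subst (asm) pt_eq_iff[where e = e]) (auto simp: reps_self)
  moreover have "v + w' \<noteq> - (v + w)"
  proof
    assume "v + w' = - (v + w)"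
    then have "b (v + w') (v + w) = b (- (v + w)) (v + w)" by (rule arg_cong)
    then have "e = - e" using w v by (simp add: reps_self)
    then have "2 * e = 0" by (simp add: eq_neg_iff_add_eq_0)
    with e two show False by simp
  qed
  ultimately show "w = w'" by simp
qed

lemma card_C: "v \<in> reps \<Longrightarrow> card (C v) = card p"
  by (rule card_image[OF inj_on_coset_pt])

lemma nbhd_C:
  assumes "v \<in> reps"
  shows "nbhd G (pt u) \<inter> C v = (\<lambda>w. pt (v + w)) ` {w \<in> p. b u (v + w) = 0}"
proof -
  have "nbhd G (pt u) \<inter> C v = {x \<in> C v. pt u \<subseteq> perp \<sigma> x}"
    using C_subset_verts[OF assms] by (auto simp: nbhd_def)
  also have "\<dots> = (\<lambda>w. pt (v + w)) ` {w \<in> p. b u (v + w) = 0}"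
    unfolding pt_subset_perp[symmetric] by blast
  finally show ?thesis .
qed

lemma card_nbhd_C:
  assumes "v \<in> reps"
  shows "card (nbhd G (pt u) \<inter> C v) = card {w \<in> p. b u (v + w) = 0}"
  unfolding nbhd_C[OF assms]
  by (rule card_image) (rule inj_on_subset[OF inj_on_coset_pt[OF assms]], blast)

lemma nbhd_C_perp:
  assumes "v \<in> reps" "\<And>w. w \<in> p \<Longrightarrow> b u w = 0"
  shows "nbhd G (pt u) \<inter> C v = (if b u v = 0 then C v else {})"
  unfolding nbhd_C[OF assms(1)] using assms(2) by auto

text \<open>Along the multiples of \<open>w0\<close> the pairing with \<open>u\<close> takes every
  value, so such a vertex sees some points of the class but not all.\<close>

lemma nbhd_C_nonperp:
  assumes v: "v \<in> reps" and w0: "w0 \<in> p" "b u w0 \<noteq> 0"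
  shows "\<exists>w\<in>p. b u (v + w) = 0" and "\<exists>w\<in>p. b u (v + w) \<noteq> 0"
proof -
  have m: "c *s w0 \<in> p" for c using w0 sub by (simp add: vec.subspace_scale)
  have "b u (v + (- b u v / b u w0) *s w0) = 0" using w0 by simp
  then show "\<exists>w\<in>p. b u (v + w) = 0" using m by blast
  have "b u (v + ((1 - b u v) / b u w0) *s w0) \<noteq> 0" using w0 by simp
  then show "\<exists>w\<in>p. b u (v + w) \<noteq> 0" using m by blast
qed

text \<open>The two solution sets are fibres of the same functional on \<open>p\<close>; translation
  by \<open>t\<close> carries one to the other.\<close>

lemma card_nbhd_C_nonperp:
  assumes w0: "w0 \<in> p" "b u w0 \<noteq> 0"
  shows "card (nbhd G (pt u) \<inter> C v\<^sub>1) = card (nbhd G (pt u) \<inter> C v\<^sub>2)"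
proof -
  define t where "t = ((b u v\<^sub>1 - b u v\<^sub>2) / b u w0) *s w0"
  have t: "t \<in> p" "b u t = b u v\<^sub>1 - b u v\<^sub>2"
    using w0 sub by (auto simp: t_def vec.subspace_scale)
  have "bij_betw (\<lambda>w. w + t) {w \<in> p. b u (v\<^sub>1 + w) = 0} {w \<in> p. b u (v\<^sub>2 + w) = 0}"
    by (rule bij_betw_byWitness[where f' = "\<lambda>w. w - t"])
       (use t sub in \<open>auto simp: vec.subspace_add vec.subspace_diff add.commute\<close>)
  then show ?thesis
    by (simp only: card_nbhd_C reps_def insertI1 insertI2 bij_betw_same_card)
qed

lemma reps1: "v\<^sub>1 \<in> reps" and reps2: "v\<^sub>2 \<in> reps"
  by (auto simp: reps_def)

lemma zero_mem: "0 \<in> p"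
  using sub by (rule vec.subspace_0)

lemma card_nbhd_coset:
  assumes "v \<in> reps" "v' \<in> reps" "w \<in> p"
  shows "card (nbhd G (pt (v + w)) \<inter> C v') = (if b v v' = 0 then card p else 0)"
proof -
  have "{w' \<in> p. b (v + w) (v' + w') = 0} = (if b v v' = 0 then p else {})"
    using assms by auto
  then show ?thesis unfolding card_nbhd_C[OF assms(2)] by simp
qed

text \<open>Adding elements of \<open>p\<close> does not change pairings among the
  \<open>v + w\<close>. So each class is a coclique because \<open>e \<noteq> 0\<close>, and between
  the classes there are all edges or none according to whether
  \<open>b v\<^sub>1 v\<^sub>2 = 0\<close>.\<close>

lemma switching_set_tangent_pair: "switching_set G (C v\<^sub>1) (C v\<^sub>2)"
  unfolding switching_set_def
proof (intro conjI)
  show "card (C v\<^sub>1) = card (C v\<^sub>2)" by (simp only: card_C reps1 reps2)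
  have "induced_regular G (C v) 0" if "v \<in> reps" for v
    unfolding induced_regular_def using card_nbhd_coset[OF that that] reps_self[OF that] e by auto
  then show "\<exists>k. induced_regular G (C v\<^sub>1) k \<and> induced_regular G (C v\<^sub>2) k"
    using reps1 reps2 by blast
  have "induced_regular G (C v\<^sub>1 \<union> C v\<^sub>2) (if b v\<^sub>1 v\<^sub>2 = 0 then card p else 0)"
    unfolding induced_regular_def
  proof
    fix x assume "x \<in> C v\<^sub>1 \<union> C v\<^sub>2"
    then obtain v w where x: "v \<in> reps" "w \<in> p" "x = pt (v + w)" using reps1 reps2 by blast
    have "card (nbhd G x \<inter> (C v\<^sub>1 \<union> C v\<^sub>2)) = card (nbhd G x \<inter> C v\<^sub>1) + card (nbhd G x \<inter> C v\<^sub>2)"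
      unfolding Int_Un_distrib by (rule card_Un_disjoint) (use disj in auto)
    also have "\<dots> = (if b v\<^sub>1 v\<^sub>2 = 0 then card p else 0)"
      unfolding x(3) card_nbhd_coset[OF x(1) reps1 x(2)] card_nbhd_coset[OF x(1) reps2 x(2)]
      using x(1) vv e b_commute[of v\<^sub>2 v\<^sub>1] by (auto simp: reps_def)
    finally show "card (nbhd G x \<inter> (C v\<^sub>1 \<union> C v\<^sub>2)) = (if b v\<^sub>1 v\<^sub>2 = 0 then card p else 0)" .
  qed
  then show "\<exists>l. induced_regular G (C v\<^sub>1 \<union> C v\<^sub>2) l" by blast
  show "\<forall>x\<in>verts G - (C v\<^sub>1 \<union> C v\<^sub>2).
       card (nbhd G x \<inter> C v\<^sub>1) = card (nbhd G x \<inter> C v\<^sub>2) \<or>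
       nbhd G x \<inter> (C v\<^sub>1 \<union> C v\<^sub>2) \<in> {C v\<^sub>1, C v\<^sub>2}"
  proof
    fix x assume "x \<in> verts G - (C v\<^sub>1 \<union> C v\<^sub>2)"
    then obtain u where x: "x = pt u" by auto
    show "card (nbhd G x \<inter> C v\<^sub>1) = card (nbhd G x \<inter> C v\<^sub>2) \<or>
       nbhd G x \<inter> (C v\<^sub>1 \<union> C v\<^sub>2) \<in> {C v\<^sub>1, C v\<^sub>2}"
    proof (cases "\<forall>w\<in>p. b u w = 0")
      case True
      then have n: "nbhd G (pt u) \<inter> C v = (if b u v = 0 then C v else {})" if "v \<in> reps" for v
        by (intro nbhd_C_perp that) blast
      show ?thesis
        unfolding x Int_Un_distrib n[OF reps1] n[OF reps2] using card_C[OF reps1] card_C[OF reps2]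
        by (cases "b u v\<^sub>1 = 0"; cases "b u v\<^sub>2 = 0") simp_all
    next
      case False
      then show ?thesis unfolding x using card_nbhd_C_nonperp by blast
    qed
  qed
qed (use C_subset_verts reps1 reps2 disj in auto)

text \<open>Such a vertex sees each class completely or not at all. If it sees exactly one class,
  switching exchanges them; if it sees both or neither, exchanging them changes nothing. Hence one
  formula covers all cases.\<close>

lemma switched_nbhd_perp:
  assumes "\<And>w. w \<in> p \<Longrightarrow> b u w = 0"
  shows "switched_nbhd G (C v\<^sub>1) (C v\<^sub>2) (pt u)
    = (if b u v\<^sub>2 = 0 then C v\<^sub>1 else {}) \<union> (if b u v\<^sub>1 = 0 then C v\<^sub>2 else {})"
proof -
  have N: "nbhd G (pt u) \<inter> (C v\<^sub>1 \<union> C v\<^sub>2)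
     = (if b u v\<^sub>1 = 0 then C v\<^sub>1 else {}) \<union> (if b u v\<^sub>2 = 0 then C v\<^sub>2 else {})"
    unfolding Int_Un_distrib using assms by (simp only: nbhd_C_perp reps1 reps2)
  have gen: "(let N = (if P then A else {}) \<union> (if Q then B else {})
      in if N = B then A else if N = A then B else N)
    = (if Q then A else {}) \<union> (if P then B else {})"
    if "A \<noteq> {}" "B \<noteq> {}" "A \<inter> B = {}" for A B :: "('a ^ 'n) set set" and P Q
  proof -
    have "A \<noteq> B" "A \<union> B \<noteq> A" "A \<union> B \<noteq> B" "{} \<noteq> A" "{} \<noteq> B" using that by blast+
    then show ?thesis by (cases P; cases Q) simp_all
  qed
  show ?thesis
    unfolding switched_nbhd_def N by (rule gen) (use disj zero_mem in blast)+
qed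

text \<open>The neighbourhood meets both classes, so it equals neither of them and is left
  alone.\<close>

lemma switched_nbhd_nonperp:
  assumes w0: "w0 \<in> p" "b u w0 \<noteq> 0"
  shows "switched_nbhd G (C v\<^sub>1) (C v\<^sub>2) (pt u) = nbhd G (pt u) \<inter> (C v\<^sub>1 \<union> C v\<^sub>2)"
proof -
  let ?N = "nbhd G (pt u) \<inter> (C v\<^sub>1 \<union> C v\<^sub>2)"
  have ex: "nbhd G (pt u) \<inter> C v \<noteq> {}" if v: "v \<in> reps" for v
    unfolding nbhd_C[OF v] using nbhd_C_nonperp(1)[OF v w0] by blast
  have "?N \<noteq> C v\<^sub>1" "?N \<noteq> C v\<^sub>2" using disj ex[OF reps1] ex[OF reps2] by blast+
  then show ?thesis unfolding switched_nbhd_def Let_def by (simp only: if_False)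
qed

section \<open>Adjacency and cliques after switching\<close>

abbreviation G' :: "('a ^ 'n) set graph" where
  "G' \<equiv> switch G (C v\<^sub>1) (C v\<^sub>2)"

lemma adj_switch:
  shows "x \<in> verts G - (C v\<^sub>1 \<union> C v\<^sub>2) \<Longrightarrow> y \<in> C v\<^sub>1 \<union> C v\<^sub>2 \<Longrightarrow>
      adj G' x y \<longleftrightarrow> y \<in> switched_nbhd G (C v\<^sub>1) (C v\<^sub>2) x"
    and "x \<in> C v\<^sub>1 \<union> C v\<^sub>2 \<Longrightarrow> y \<in> verts G - (C v\<^sub>1 \<union> C v\<^sub>2) \<Longrightarrow>
      adj G' x y \<longleftrightarrow> x \<in> switched_nbhd G (C v\<^sub>1) (C v\<^sub>2) y"
    and "x \<notin> C v\<^sub>1 \<union> C v\<^sub>2 \<Longrightarrow> y \<notin> C v\<^sub>1 \<union> C v\<^sub>2 \<Longrightarrow> adj G' x y \<longleftrightarrow> adj G x y"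
    and "x \<in> C v\<^sub>1 \<union> C v\<^sub>2 \<Longrightarrow> y \<in> C v\<^sub>1 \<union> C v\<^sub>2 \<Longrightarrow> adj G' x y \<longleftrightarrow> adj G x y"
  unfolding switch_def Let_def graph.simps by (simp_all only: Diff_iff simp_thms if_True if_False)

lemma verts_switch: "verts G' = verts G"
  by (simp add: switch_def)

definition perp_p :: "'a ^ 'n \<Rightarrow> bool" where "perp_p u \<longleftrightarrow> (\<forall>w\<in>p. b u w = 0)"

lemma perp_p_C:
  assumes "pt u \<in> C v\<^sub>1 \<union> C v\<^sub>2"
  shows "perp_p u"
proof -
  obtain v w where v: "v \<in> reps" "w \<in> p" "pt u = pt (v + w)"
    using assms reps1 reps2 by blast
  obtain c where "u = c *s (v + w)" using pt_eqD[OF v(3)] .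
  then show ?thesis using v by (simp add: perp_p_def)
qed

lemma v1_mem_C: "pt v\<^sub>1 \<in> C v\<^sub>1"
  using zero_mem by force

text \<open>Switching replaces the condition \<open>u \<bottom> v\<^sub>1\<close> by \<open>u \<bottom> v\<^sub>2\<close> for the vectors \<open>u\<close>
  that are perpendicular to \<open>p\<close>, and leaves it unchanged for all others.\<close>

lemma v1_mem_switched_nbhd:
  "pt v\<^sub>1 \<in> switched_nbhd G (C v\<^sub>1) (C v\<^sub>2) (pt u) \<longleftrightarrow>
    (if perp_p u then b u v\<^sub>2 = 0 else b u v\<^sub>1 = 0)"
proof (cases "perp_p u")
  case True
  have "pt v\<^sub>1 \<notin> C v\<^sub>2" using disj v1_mem_C by blast
  then show ?thesis
    using True v1_mem_C by (subst switched_nbhd_perp) (auto simp: perp_p_def simp del: image_iff)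
next
  case False
  then obtain w0 where w0: "w0 \<in> p" "b u w0 \<noteq> 0" by (auto simp: perp_p_def)
  have "pt v\<^sub>1 \<in> verts G" using vv by simp
  then show ?thesis
    unfolding switched_nbhd_nonperp[OF w0] using v1_mem_C False
    by (simp add: nbhd_def pt_subset_perp del: image_iff)
qed

text \<open>The points of \<open>v\<^sub>1 # ks\<close> form a clique of the switched graph. An
  isomorphism would send it to a clique of the original graph, which has as many common neighbours
  as \<open>v\<^sub>2 # ks\<close>. The common neighbours perpendicular to \<open>p\<close> agree on
  both sides, so the remaining ones would be equally numerous, against \<open>neq\<close>. The
  vertex \<open>k0\<close> keeps the points of the two classes out of the count.\<close>

lemma not_graph_iso_switch:
  assumes ks: "\<And>k. k \<in> set ks \<Longrightarrow> b k k = e" "sorted_wrt (\<lambda>x y. b x y = 0) ks"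
    "\<And>k. k \<in> set ks \<Longrightarrow> pt k \<notin> C v\<^sub>1 \<union> C v\<^sub>2"
    "\<And>k. k \<in> set ks \<Longrightarrow> b k v\<^sub>2 = 0"
    "\<And>k. k \<in> set ks \<Longrightarrow> \<not> perp_p k \<Longrightarrow> b k v\<^sub>1 = 0"
    and k0: "k0 \<in> set ks" "perp_p k0" "b k0 v\<^sub>1 \<noteq> 0"
    and neq: "card {u \<in> common_perp e (set ks). \<not> perp_p u \<and> b u v\<^sub>1 = 0}
      \<noteq> card {u \<in> common_perp e (set ks). \<not> perp_p u \<and> b u v\<^sub>2 = 0}"
  shows "\<not> graph_iso G' G"
proof
  assume "graph_iso G' G"
  then obtain f where f: "bij_betw f (verts G) (verts G)"
    "\<And>x y. x \<in> verts G \<Longrightarrow> y \<in> verts G \<Longrightarrow> adj G' x y \<longleftrightarrow> adj G (f x) (f y)"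
    unfolding graph_iso_def verts_switch by blast
  have pt_verts: "b u u = e \<Longrightarrow> pt u \<in> verts G" for u by simp
  have kD: "pt k \<in> verts G - (C v\<^sub>1 \<union> C v\<^sub>2)" if "k \<in> set ks" for k
    using ks(3)[OF that] pt_verts[OF ks(1)[OF that]] by blast
  have v1V: "pt v\<^sub>1 \<in> verts G" using pt_verts vv by blast
  have v1C: "pt v\<^sub>1 \<in> C v\<^sub>1 \<union> C v\<^sub>2" using v1_mem_C by blast
  \<comment> \<open>The map \<open>f\<close> acts on points only; spanning vectors of value
    \<open>e\<close> are chosen for the images so that the count for orthogonal lists
    applies.\<close>
  have "\<forall>k\<in>set (v\<^sub>1 # ks). \<exists>k'. b k' k' = e \<and> f (pt k) = pt k'"
  proof
    fix k assume "k \<in> set (v\<^sub>1 # ks)"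
    then have "b k k = e" using ks(1) vv by auto
    then have "f (pt k) \<in> verts G" using f(1) pt_verts by (blast dest: bij_betwE)
    then show "\<exists>k'. b k' k' = e \<and> f (pt k) = pt k'" by auto
  qed
  then obtain h where h: "\<And>k. k \<in> set (v\<^sub>1 # ks) \<Longrightarrow> b (h k) (h k) = e \<and> f (pt k) = pt (h k)"
    by metis
  have adj_h: "b (h k) (h l) = 0" if "k \<in> set (v\<^sub>1 # ks)" "l \<in> set (v\<^sub>1 # ks)" "adj G' (pt k) (pt l)" for k l
  proof -
    have "b k k = e" "b l l = e" using that ks(1) vv by auto
    then have "adj G (f (pt k)) (f (pt l))" using f(2) pt_verts that(3) by blast
    then show ?thesis using h[OF that(1)] h[OF that(2)] by (simp add: pt_subset_perp)
  qed
  have adj1: "adj G' (pt v\<^sub>1) (pt k)" if "k \<in> set ks" for k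
    using adj_switch(2)[OF v1C kD[OF that]] v1_mem_switched_nbhd[of k] ks(4,5)[OF that] by simp
  have adj2: "adj G' (pt k) (pt l)" if "k \<in> set ks" "l \<in> set ks" "b k l = 0" for k l
    using adj_switch(3)[OF ks(3)[OF that(1)] ks(3)[OF that(2)]] that(3) by (simp add: pt_subset_perp)
  have sorted: "sorted_wrt (\<lambda>x y. b x y = 0) (map h (v\<^sub>1 # ks))"
  proof -
    have "sorted_wrt (\<lambda>x y. b (h x) (h y) = 0) ks"
      by (rule sorted_wrt_mono_rel[OF _ ks(2)]) (auto intro!: adj_h adj2)
    then show ?thesis using adj1 adj_h by (auto simp: sorted_wrt_map)
  qed
  let ?K = "set (map h (v\<^sub>1 # ks))" and ?K2 = "set (v\<^sub>2 # ks)"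
  \<comment> \<open>These vectors represent the common neighbours of the clique in the switched
    graph, as \<open>adjX\<close> shows.\<close>
  define X where "X = {u \<in> common_perp e (set ks). if perp_p u then b u v\<^sub>2 = 0 else b u v\<^sub>1 = 0}"
  have adjX: "(\<forall>k\<in>set (v\<^sub>1 # ks). adj G' (pt u) (pt k)) \<longleftrightarrow> u \<in> X" if u: "b u u = e" for u
  proof (cases "pt u \<in> C v\<^sub>1 \<union> C v\<^sub>2")
    case True
    have kp: "\<And>w. w \<in> p \<Longrightarrow> b k0 w = 0" using k0(2) by (simp add: perp_p_def)
    \<comment> \<open>A point of the first class is not perpendicular to \<open>k0\<close>, nor
      adjacent to \<open>v\<^sub>1\<close>, the class being a coclique. A point of the second class
      is not perpendicular to \<open>v\<^sub>2\<close> and loses its edge to \<open>k0\<close> by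
      switching.\<close>
    from True have "(b u k0 \<noteq> 0 \<or> b u v\<^sub>2 \<noteq> 0) \<and> (\<not> adj G' (pt u) (pt v\<^sub>1) \<or> \<not> adj G' (pt u) (pt k0))"
    proof
      assume "pt u \<in> C v\<^sub>1"
      then obtain w where w: "w \<in> p" "pt u = pt (v\<^sub>1 + w)" by blast
      obtain c where c: "u = c *s (v\<^sub>1 + w)" using pt_eqD[OF w(2)] .
      have "c \<noteq> 0" using c u e by auto
      then have "b u k0 \<noteq> 0" "b u v\<^sub>1 \<noteq> 0"
        using c w(1) k0(3) kp[OF w(1)] vv(1) e reps1 b_commute[of v\<^sub>1 k0] b_commute[of w k0] by auto
      moreover have "adj G' (pt u) (pt v\<^sub>1) \<longleftrightarrow> b u v\<^sub>1 = 0"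
        using adj_switch(4)[OF True v1C] by (simp add: pt_subset_perp)
      ultimately show ?thesis by blast
    next
      assume uC: "pt u \<in> C v\<^sub>2"
      then obtain w where w: "w \<in> p" "pt u = pt (v\<^sub>2 + w)" by blast
      obtain c where c: "u = c *s (v\<^sub>2 + w)" using pt_eqD[OF w(2)] .
      have "c \<noteq> 0" using c u e by auto
      then have "b u v\<^sub>2 \<noteq> 0" using c w(1) vv(2) e reps2 by auto
      moreover have "switched_nbhd G (C v\<^sub>1) (C v\<^sub>2) (pt k0) = C v\<^sub>1"
        by (subst switched_nbhd_perp) (use kp k0(3) ks(4)[OF k0(1)] in simp_all)
      then have "\<not> adj G' (pt u) (pt k0)"
        using adj_switch(2)[OF True kD[OF k0(1)]] uC disj by blast
      ultimately show ?thesis by blast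
    qed
    then have na: "\<not> adj G' (pt u) (pt v\<^sub>1) \<or> \<not> adj G' (pt u) (pt k0)"
      and nX: "u \<notin> X" using perp_p_C[OF True] k0(1) by (auto simp: X_def common_perp_def)
    then show ?thesis using na nX k0(1) by auto
  next
    case False
    then have D: "pt u \<in> verts G - (C v\<^sub>1 \<union> C v\<^sub>2)" using pt_verts[OF u] by blast
    have "adj G' (pt u) (pt k) \<longleftrightarrow> b u k = 0" if "k \<in> set ks" for k
      using adj_switch(3)[OF False ks(3)[OF that]] by (simp add: pt_subset_perp)
    moreover have "adj G' (pt u) (pt v\<^sub>1) \<longleftrightarrow> (if perp_p u then b u v\<^sub>2 = 0 else b u v\<^sub>1 = 0)"
      using adj_switch(1)[OF D v1C] v1_mem_switched_nbhd by simp
    ultimately show ?thesis using u by (auto simp: X_def common_perp_def)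
  qed
  have "bij_betw f (pt ` X) (pt ` common_perp e ?K)"
  proof -
    have X: "pt ` X = {x \<in> verts G. \<forall>k\<in>set (v\<^sub>1 # ks). adj G' x (pt k)}"
    proof (intro equalityI subsetI)
      fix x assume "x \<in> pt ` X"
      then obtain u where u: "u \<in> X" "x = pt u" by blast
      then have "b u u = e" by (simp add: X_def common_perp_def)
      then show "x \<in> {x \<in> verts G. \<forall>k\<in>set (v\<^sub>1 # ks). adj G' x (pt k)}"
        using adjX[of u] u pt_verts by blast
    next
      fix x assume x: "x \<in> {x \<in> verts G. \<forall>k\<in>set (v\<^sub>1 # ks). adj G' x (pt k)}"
      then obtain u where u: "b u u = e" "x = pt u" by auto
      then show "x \<in> pt ` X" using x adjX[OF u(1)] by blast
    qed
    have Y: "pt ` common_perp e ?K = {x \<in> verts G. \<forall>k\<in>set (v\<^sub>1 # ks). adj G x (f (pt k))}"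
    proof -
      have "(\<forall>k\<in>set (v\<^sub>1 # ks). adj G (pt u) (f (pt k))) \<longleftrightarrow> (\<forall>k\<in>?K. b u k = 0)" for u
        using h by (simp add: pt_subset_perp)
      then have "common_perp e ?K = {u. b u u = e \<and> (\<forall>k\<in>set (v\<^sub>1 # ks). adj G (pt u) (f (pt k)))}"
        unfolding common_perp_def by blast
      moreover have "pt ` {u. P u \<and> Q (pt u)} = {x \<in> pt ` {u. P u}. Q x}" for P Q by blast
      note this[of "\<lambda>u. b u u = e" "\<lambda>x. \<forall>k\<in>set (v\<^sub>1 # ks). adj G x (f (pt k))"]
      ultimately show ?thesis by (simp only: graph.simps)
    qed
    have kV: "pt k \<in> verts G" if "k \<in> set (v\<^sub>1 # ks)" for k
      using that v1V kD by auto
    have "f ` (pt ` X) = pt ` common_perp e ?K"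
    proof (intro equalityI subsetI)
      fix y assume "y \<in> f ` (pt ` X)"
      then obtain x where "y = f x" "x \<in> verts G" "\<forall>k\<in>set (v\<^sub>1 # ks). adj G' x (pt k)"
        unfolding X by blast
      then show "y \<in> pt ` common_perp e ?K"
        unfolding Y using f(2) kV bij_betwE[OF f(1)] by blast
    next
      fix y assume "y \<in> pt ` common_perp e ?K"
      then have y: "y \<in> verts G" "\<forall>k\<in>set (v\<^sub>1 # ks). adj G y (f (pt k))" unfolding Y by blast+
      then obtain x where "y = f x" "x \<in> verts G" using bij_betw_imp_surj_on[OF f(1)] by blast
      then show "y \<in> f ` (pt ` X)" unfolding X using y f(2) kV by blast
    qed
    moreover have "inj_on f (pt ` X)"
      by (rule inj_on_subset[OF bij_betw_imp_inj_on[OF f(1)]]) (use X in blast)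
    ultimately show ?thesis by (simp add: bij_betw_def)
  qed
  then have "card (pt ` X) = card (pt ` common_perp e ?K)" by (rule bij_betw_same_card)
  moreover have "card X = 2 * card (pt ` X)"
    by (rule card_pt_image[OF e]) (auto simp: X_def common_perp_def perp_p_def)
  moreover have "card (common_perp e ?K) = 2 * card (pt ` common_perp e ?K)"
    by (rule card_pt_image[OF e]) (auto simp: common_perp_def)
  moreover have "card (common_perp e ?K) = card (common_perp e ?K2)"
  proof (rule card_common_perp_eq[OF _ e sorted])
    show "\<forall>u\<in>?K. b u u = e" using h by auto
    show "sorted_wrt (\<lambda>x y. b x y = 0) (v\<^sub>2 # ks)" using ks(2,4) b_commute by auto
    show "\<forall>u\<in>?K2. b u u = e" using ks(1) vv by auto
  qed simp
  ultimately have "card X = card (common_perp e ?K2)" by simp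
  \<comment> \<open>For vectors perpendicular to \<open>p\<close> the condition in \<open>X\<close>
    is perpendicularity to \<open>v\<^sub>2\<close>, so this part is common to both counts and
    cancels.\<close>
  moreover have "card X = card {u \<in> common_perp e ?K2. perp_p u}
     + card {u \<in> common_perp e (set ks). \<not> perp_p u \<and> b u v\<^sub>1 = 0}"
    by (subst card_Un_disjoint[symmetric]) (auto simp: X_def common_perp_def intro!: arg_cong[of _ _ card])
  moreover have "card (common_perp e ?K2) = card {u \<in> common_perp e ?K2. perp_p u}
     + card {u \<in> common_perp e (set ks). \<not> perp_p u \<and> b u v\<^sub>2 = 0}"
    by (subst card_Un_disjoint[symmetric]) (auto simp: common_perp_def intro!: arg_cong[of _ _ card])
  ultimately show False using neq by simp
qed

subsection \<open>A clique with the wrong number of common neighbours\<close>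

text \<open>An orthogonal basis made of \<open>z\<close>, \<open>z'\<close>,
  \<open>v\<^sub>2\<close>, the vectors \<open>y1 # y2 # ys\<close> of value \<open>e\<close>, then
  \<open>v0\<close> and \<open>s\<close>. The component of \<open>v\<^sub>1\<close> perpendicular to
  \<open>v\<^sub>2\<close> must split as prescribed, with the part \<open>v0\<close> of value
  \<open>e * s0\<close>. A vector \<open>w\<close> of that shape is built first and then moved to
  this component by an isometry.\<close>

lemma adapted_frame:
  assumes card: "CARD('n) \<ge> 7"
    and z: "b z z = e" "b z z' = 0" "b z' z' = - e"
    and vz: "b v\<^sub>1 z = 0" "b v\<^sub>1 z' = 0" "b v\<^sub>2 z = 0" "b v\<^sub>2 z' = 0"
    and a: "b v\<^sub>1 v\<^sub>2 = e * a"
    and r: "r \<noteq> 0" "a\<^sup>2 + r\<^sup>2 = 1"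
    and g: "\<not> is_square g"
    and s0: "s0 * r\<^sup>2 = g - a\<^sup>2"
  obtains c1 c2 r' y1 y2 v0 ys s where
    "r'\<^sup>2 = r\<^sup>2" "c1 \<noteq> 0 \<or> c2 \<noteq> 0"
    "v\<^sub>1 = a *s v\<^sub>2 + r' *s (c1 *s y1 + c2 *s y2 + v0)"
    "b v0 v0 = e * s0" "b s s \<noteq> 0" "b s v0 = 0"
    "\<And>y. y \<in> set (y1 # y2 # ys) \<Longrightarrow> b y y = e \<and> b y v0 = 0 \<and> b y s = 0"
    "sorted_wrt (\<lambda>x y. b x y = 0) (y1 # y2 # ys)"
    "\<And>x. x \<in> set (v0 # s # y1 # y2 # ys) \<Longrightarrow> b x z = 0 \<and> b x z' = 0 \<and> b x v\<^sub>2 = 0"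
    "\<And>u. b u z = 0 \<Longrightarrow> (\<And>y. y \<in> set (y1 # y2 # ys) \<Longrightarrow> b u y = 0) \<Longrightarrow>
      \<exists>t x i j. u = t *s z' + x *s v\<^sub>2 + i *s v0 + j *s s"
proof -
  define v' where "v' = (1 / r) *s (v\<^sub>1 - a *s v\<^sub>2)"
  have v1: "v\<^sub>1 = a *s v\<^sub>2 + r *s v'" using r by (simp add: v'_def)
  have v'v2: "b v' v\<^sub>2 = 0" using a vv by (simp add: v'_def)
  have v'v': "b v' v' = e"
  proof -
    have "e = b (a *s v\<^sub>2 + r *s v') (a *s v\<^sub>2 + r *s v')" using v1 vv by simp
    also have "\<dots> = e * a\<^sup>2 + r\<^sup>2 * b v' v'"
      using v'v2 vv b_commute[of v\<^sub>2 v'] by (simp add: power2_eq_square mult_ac)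
    finally have "r\<^sup>2 * b v' v' = r\<^sup>2 * e" using r(2) by algebra
    then show ?thesis using r(1) by simp
  qed
  have v'z: "b v' z = 0" "b v' z' = 0" using vz by (simp_all add: v'_def)
  let ?S1 = "UNIV \<inter> orth z"
  let ?S2 = "?S1 \<inter> orth z'"
  let ?S = "?S2 \<inter> orth v\<^sub>2"
  have z0: "b z z \<noteq> 0" "b z' z' \<noteq> 0" "b v\<^sub>2 v\<^sub>2 \<noteq> 0" using z vv e by auto
  have m: "z' \<in> ?S1" "v\<^sub>2 \<in> ?S2" using z vz b_commute[of z' z] by (auto simp: orth_def)
  have nd1: "nondeg_on ?S1" by (rule nondeg_on_orth(1)[OF nondeg_on_UNIV UNIV_I z0(1)])
  have nd2: "nondeg_on ?S2" by (rule nondeg_on_orth(1)[OF nd1 m(1) z0(2)])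
  have ndS: "nondeg_on ?S" by (rule nondeg_on_orth(1)[OF nd2 m(2) z0(3)])
  have dimS: "CARD('n) = vec.dim ?S + 3"
    using nondeg_on_orth(2)[OF nondeg_on_UNIV UNIV_I z0(1)] nondeg_on_orth(2)[OF nd1 m(1) z0(2)]
      nondeg_on_orth(2)[OF nd2 m(2) z0(3)] vec_dim_card[where 'a = 'a and 'n = 'n]
    by simp
  have s00: "s0 \<noteq> 0"
  proof
    assume "s0 = 0"
    then have "g = a\<^sup>2" using s0 by simp
    with g show False by (auto simp: is_nth_power_def)
  qed
  obtain c1 c2 where c: "1 * c1\<^sup>2 + 1 * c2\<^sup>2 = 1 - s0"
    using binary_form_universal[OF two, of 1 1] by auto
  \<comment> \<open>Otherwise \<open>g = a\<^sup>2 + r\<^sup>2 = 1\<close> would be a square. Later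
    this provides a vector among \<open>y1\<close>, \<open>y2\<close> that is not perpendicular to
    \<open>v\<^sub>1\<close>.\<close>
  have c0: "c1 \<noteq> 0 \<or> c2 \<noteq> 0"
  proof (rule ccontr)
    assume "\<not> ?thesis"
    then have "s0 = 1" using c by simp
    then have "g = 1\<^sup>2" using s0 r(2) by (simp add: algebra_simps)
    with g show False unfolding is_nth_power_def by blast
  qed
  obtain x1 where x1: "x1 \<in> ?S" "b x1 x1 = e" using nondeg_on_represents[OF ndS] dimS card by auto
  have x10: "b x1 x1 \<noteq> 0" using x1 e by simp
  let ?T1 = "?S \<inter> orth x1"
  have ndT1: "nondeg_on ?T1" and dimT1: "vec.dim ?S = Suc (vec.dim ?T1)" using nondeg_on_orth[OF ndS x1(1) x10] .
  obtain x2 where x2: "x2 \<in> ?T1" "b x2 x2 = e" using nondeg_on_represents[OF ndT1] dimS dimT1 card by auto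
  have x20: "b x2 x2 \<noteq> 0" using x2 e by simp
  let ?T2 = "?T1 \<inter> orth x2"
  have ndT2: "nondeg_on ?T2" and dimT2: "vec.dim ?T1 = Suc (vec.dim ?T2)" using nondeg_on_orth[OF ndT1 x2(1) x20] .
  \<comment> \<open>By \<open>card\<close> the space \<open>?S\<close> has dimension at least 4, so
    at least 2 dimensions remain here, enough to represent any value.\<close>
  obtain w0 where w0: "w0 \<in> ?T2" "b w0 w0 = e * s0"
    using nondeg_on_represents[OF ndT2] dimS dimT1 dimT2 card by auto
  have xo: "b x2 x1 = 0" "b w0 x1 = 0" "b w0 x2 = 0" "b x1 x2 = 0" "b x1 w0 = 0" "b x2 w0 = 0"
    using x2(1) w0(1) b_commute[of x1 x2] b_commute[of x1 w0] b_commute[of x2 w0] by (auto simp: orth_def)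
  define w where "w = c1 *s x1 + c2 *s x2 + w0"
  have ww: "b w w = e"
  proof -
    have "b w w = e * (1 * c1\<^sup>2 + 1 * c2\<^sup>2) + e * s0"
      using xo x1(2) x2(2) w0(2) by (simp add: w_def power2_eq_square algebra_simps)
    then show ?thesis unfolding c by (simp add: algebra_simps)
  qed
  obtain h where h: "\<And>u v. b (h u) (h v) = b u v" "h w = v' \<or> h w = - v'"
    "\<And>t. b t w = 0 \<Longrightarrow> b t v' = 0 \<Longrightarrow> h t = t"
    "\<And>u v. h (u + v) = h u + h v" "\<And>c u. h (c *s u) = c *s h u"
    using isometry_swap[OF ww v'v' e] by metis
  have wS: "b w z = 0" "b w z' = 0" "b w v\<^sub>2 = 0"
    using x1(1) x2(1) w0(1) by (simp_all add: w_def orth_def)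
  \<comment> \<open>These three vectors are perpendicular to both \<open>w\<close> and
    \<open>v'\<close>, so moving \<open>w\<close> preserves the part of the frame already
    fixed.\<close>
  have hfix: "h z = z" "h z' = z'" "h v\<^sub>2 = v\<^sub>2"
    using wS v'z v'v2 by (simp_all add: h(3) b_commute[of _ w] b_commute[of _ v'])
  define y1 y2 v0 where "y1 = h x1" and "y2 = h x2" and "v0 = h w0"
  have hS: "h x \<in> ?S" if "x \<in> ?S" for x
    using that h(1)[of x z] h(1)[of x z'] h(1)[of x v\<^sub>2] hfix by (simp add: orth_def)
  have yS: "y1 \<in> ?S" "y2 \<in> ?S" "v0 \<in> ?S"
    using hS x1(1) x2(1) w0(1) by (auto simp: y1_def y2_def v0_def)
  have yy: "b y1 y1 = e" "b y2 y2 = e" "b v0 v0 = e * s0" "b y1 y2 = 0" "b y2 y1 = 0"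
    "b v0 y1 = 0" "b v0 y2 = 0" "b y1 v0 = 0" "b y2 v0 = 0"
    using x1 x2 w0 xo by (simp_all add: y1_def y2_def v0_def h(1))
  have hw: "h w = c1 *s y1 + c2 *s y2 + v0" by (simp add: w_def h(4,5) y1_def y2_def v0_def)
  \<comment> \<open>The undetermined sign of \<open>h w\<close> is absorbed into the
    coefficient.\<close>
  obtain r' where r': "r'\<^sup>2 = r\<^sup>2" "v\<^sub>1 = a *s v\<^sub>2 + r' *s (c1 *s y1 + c2 *s y2 + v0)"
  proof (cases "h w = v'")
    case True
    then show thesis using v1 hw by (intro that[of r]) auto
  next
    case False
    then have "h w = - v'" using h(2) by blast
    then have "v' = - (c1 *s y1 + c2 *s y2 + v0)" using hw by (metis minus_minus)
    then show thesis using v1 by (intro that[of "- r"]) auto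
  qed
  let ?U1 = "?S \<inter> orth y1"
  let ?U2 = "?U1 \<inter> orth y2"
  let ?U3 = "?U2 \<inter> orth v0"
  have y0: "b y1 y1 \<noteq> 0" "b y2 y2 \<noteq> 0" "b v0 v0 \<noteq> 0" using yy e s00 by auto
  have ymem: "y2 \<in> ?U1" "v0 \<in> ?U2" using yS yy by (auto simp: orth_def)
  have ndU1: "nondeg_on ?U1" and dimU1: "vec.dim ?S = Suc (vec.dim ?U1)" using nondeg_on_orth[OF ndS yS(1) y0(1)] .
  have ndU2: "nondeg_on ?U2" and dimU2: "vec.dim ?U1 = Suc (vec.dim ?U2)" using nondeg_on_orth[OF ndU1 ymem(1) y0(2)] .
  have ndU3: "nondeg_on ?U3" and dimU3: "vec.dim ?U2 = Suc (vec.dim ?U3)" using nondeg_on_orth[OF ndU2 ymem(2) y0(3)] .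
  have "vec.dim ?U3 = Suc (CARD('n) - 7)" using card dimS dimU1 dimU2 dimU3 by simp
  from nondeg_on_orthonormal_list[OF ndU3 this e] obtain ys s where
    ys: "length ys = CARD('n) - 7" "set ys \<subseteq> ?U3" "s \<in> ?U3" "b s s \<noteq> 0"
    "\<forall>y\<in>set ys. b y y = e \<and> b s y = 0" "sorted_wrt (\<lambda>x y. b x y = 0) ys"
    "\<forall>u\<in>?U3. (\<forall>y\<in>set ys. b u y = 0) \<longrightarrow> (\<exists>j. u = j *s s)" by (elim exE conjE)
  have U3D: "b x z = 0" "b x z' = 0" "b x v\<^sub>2 = 0" "b x y1 = 0" "b x y2 = 0" "b x v0 = 0"
     "b y1 x = 0" "b y2 x = 0" "b v0 x = 0" if "x \<in> ?U3" for x
    using that b_commute[of y1 x] b_commute[of y2 x] b_commute[of v0 x] by (auto simp: orth_def)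
  have ysU: "y \<in> ?U3" if "y \<in> set ys" for y using ys(2) that by blast
  show thesis
  proof (rule that)
    show "r'\<^sup>2 = r\<^sup>2" "v\<^sub>1 = a *s v\<^sub>2 + r' *s (c1 *s y1 + c2 *s y2 + v0)" by fact+
    show "c1 \<noteq> 0 \<or> c2 \<noteq> 0" by fact
    show "b v0 v0 = e * s0" "b s s \<noteq> 0" by fact+
    show "b s v0 = 0" using U3D[OF ys(3)] by blast
    show "b y y = e \<and> b y v0 = 0 \<and> b y s = 0" if y: "y \<in> set (y1 # y2 # ys)" for y
    proof -
      consider "y = y1" | "y = y2" | "y \<in> set ys" using y by auto
      then show ?thesis
      proof cases
        case 3
        then have "b s y = 0" "b y y = e" using ys(5) by blast+
        then show ?thesis using U3D[OF ysU[OF 3]] b_commute[of y s] by simp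
      qed (use yy U3D[OF ys(3)] in auto)
    qed
    show "sorted_wrt (\<lambda>x y. b x y = 0) (y1 # y2 # ys)"
      using yy ys(6) U3D[OF ysU] by auto
    show "b x z = 0 \<and> b x z' = 0 \<and> b x v\<^sub>2 = 0" if "x \<in> set (v0 # s # y1 # y2 # ys)" for x
    proof -
      have "x \<in> ?S" using that yS ys(3) ysU by auto
      then show ?thesis by (auto simp: orth_def)
    qed
    fix u assume u: "b u z = 0" "\<And>y. y \<in> set (y1 # y2 # ys) \<Longrightarrow> b u y = 0"
    \<comment> \<open>Coefficients of \<open>u\<close> in the orthogonal basis; the sign comes from
      \<open>b z' z' = - e\<close>.\<close>
    define t where "t = - b u z' / e"
    define x where "x = b u v\<^sub>2 / e"
    define i where "i = b u v0 / (e * s0)"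
    define u' where "u' = u - t *s z' - x *s v\<^sub>2 - i *s v0"
    have vS: "b v0 z = 0" "b v0 z' = 0" "b v0 v\<^sub>2 = 0" "b y1 z' = 0" "b y2 z' = 0" "b y1 v\<^sub>2 = 0" "b y2 v\<^sub>2 = 0"
      using yS by (auto simp: orth_def)
    have "u' \<in> ?U3"
      using u z vz vS yy vv e s00 b_commute[of z' z] b_commute[of z' v\<^sub>2] b_commute[of v\<^sub>2 v0] b_commute[of z' v0]
        b_commute[of z' y1] b_commute[of v\<^sub>2 y1] b_commute[of z' y2] b_commute[of v\<^sub>2 y2]
      by (simp add: u'_def t_def x_def i_def orth_def)
    moreover have "b u' y = 0" if "y \<in> set ys" for y
      using u(2)[of y] that U3D[OF ysU[OF that]] b_commute[of z' y] b_commute[of v\<^sub>2 y]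
      by (simp add: u'_def)
    ultimately obtain j where "u' = j *s s" using ys(7) by blast
    then have "u = t *s z' + x *s v\<^sub>2 + i *s v0 + j *s s" by (simp add: u'_def algebra_simps)
    then show "\<exists>t x i j. u = t *s z' + x *s v\<^sub>2 + i *s v0 + j *s s" by blast
  qed
qed

text \<open>The clique criterion is applied to \<open>z # y1 # y2 # ys\<close>. Its orthogonal
  complement has coordinates \<open>t, x, i, j\<close>. Perpendicularity to \<open>v\<^sub>2\<close>
  means \<open>x = 0\<close> and leaves the form \<open>(s0, \<kappa>)\<close>; perpendicularity to
  \<open>v\<^sub>1\<close> selects another line in the \<open>x, i\<close> plane and leaves
  \<open>(s0 * g, \<kappa>)\<close>.\<close>

lemma switch_not_iso:
  assumes card: "CARD('n) \<ge> 7"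
    and p: "p = range (\<lambda>c. c *s p0)"
    and z: "b z z = e" "b z p0 = e"
    and vz: "b v\<^sub>1 z = 0" "b v\<^sub>2 z = 0"
    and a: "b v\<^sub>1 v\<^sub>2 = e * a"
    and r: "r \<noteq> 0" "a\<^sup>2 + r\<^sup>2 = 1"
  shows "\<not> graph_iso G' G"
proof -
  have p0: "p0 \<in> p" unfolding p by (metis rangeI vector_smult_lid)
  \<comment> \<open>As \<open>p0\<close> is singular, \<open>z\<close> and \<open>z'\<close> form an
    orthogonal basis, of values \<open>e\<close> and \<open>- e\<close>, of a hyperbolic plane
    containing \<open>p0\<close>. On the complement of \<open>z\<close> the coefficient of
    \<open>z'\<close> measures the pairing with \<open>p0\<close>.\<close>
  define z' where "z' = p0 - z"
  have zc: "b p0 z = e" using z b_commute[of p0 z] by simp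
  have z': "b z z' = 0" "b z' z' = - e" "b z' z = 0" "b z' p0 = - e"
    using z zc pp[OF p0 p0] by (simp_all add: z'_def)
  have vp: "b v\<^sub>1 p0 = 0" "b v\<^sub>2 p0 = 0" using p0 reps1 reps2 by simp_all
  have vz': "b v\<^sub>1 z' = 0" "b v\<^sub>2 z' = 0" using vz vp by (simp_all add: z'_def)
  obtain g :: 'a where g: "\<not> is_square g" using nonsquare_exists[OF two] by blast
  \<comment> \<open>Chosen so that \<open>a\<^sup>2 + r\<^sup>2 * s0\<close> is the non-square
    \<open>g\<close>, which becomes the ratio of the two discriminants.\<close>
  define s0 where "s0 = (g - a\<^sup>2) / r\<^sup>2"
  have s0: "s0 * r\<^sup>2 = g - a\<^sup>2" using r by (simp add: s0_def)
  have s00: "s0 \<noteq> 0"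
  proof
    assume "s0 = 0"
    then have "g = a\<^sup>2" using s0 by simp
    with g show False by (auto simp: is_nth_power_def)
  qed
  obtain c1 c2 r' y1 y2 v0 ys s where
    r': "r'\<^sup>2 = r\<^sup>2" and c: "c1 \<noteq> 0 \<or> c2 \<noteq> 0"
    and v1: "v\<^sub>1 = a *s v\<^sub>2 + r' *s (c1 *s y1 + c2 *s y2 + v0)"
    and v0: "b v0 v0 = e * s0" and s: "b s s \<noteq> 0" and sv0: "b s v0 = 0"
    and y: "\<And>y. y \<in> set (y1 # y2 # ys) \<Longrightarrow> b y y = e \<and> b y v0 = 0 \<and> b y s = 0"
    and sorted: "sorted_wrt (\<lambda>x y. b x y = 0) (y1 # y2 # ys)"
    and inS: "\<And>x. x \<in> set (v0 # s # y1 # y2 # ys) \<Longrightarrow> b x z = 0 \<and> b x z' = 0 \<and> b x v\<^sub>2 = 0"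
    and spn: "\<And>u. b u z = 0 \<Longrightarrow> (\<And>y. y \<in> set (y1 # y2 # ys) \<Longrightarrow> b u y = 0) \<Longrightarrow>
      \<exists>t x i j. u = t *s z' + x *s v\<^sub>2 + i *s v0 + j *s s"
    by (rule adapted_frame[OF card z(1) z'(1,2) vz(1) vz'(1) vz(2) vz'(2) a r g s0]) blast
  have r'0: "r' \<noteq> 0" using r' r(1) by auto
  define \<kappa> where "\<kappa> = b s s / e"
  have \<kappa>: "\<kappa> \<noteq> 0" "b s s = e * \<kappa>" using s e by (auto simp: \<kappa>_def)
  have S: "b x z = 0" "b x z' = 0" "b x v\<^sub>2 = 0" "b z x = 0" "b z' x = 0" "b v\<^sub>2 x = 0" "b x p0 = 0"
    if "x \<in> set (v0 # s # y1 # y2 # ys)" for x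
  proof -
    show "b x z = 0" "b x z' = 0" "b x v\<^sub>2 = 0" using inS[OF that] by blast+
    then show "b z x = 0" "b z' x = 0" "b v\<^sub>2 x = 0" by (simp_all only: b_commute[of z x] b_commute[of z' x] b_commute[of v\<^sub>2 x])
    have "b x (z' + z) = 0" using inS[OF that] by simp
    then show "b x p0 = 0" by (simp add: z'_def del: b_add_right)
  qed
  have Sv0: "b v0 z = 0" "b v0 z' = 0" "b v0 v\<^sub>2 = 0" "b z v0 = 0" "b z' v0 = 0" "b v\<^sub>2 v0 = 0" "b v0 p0 = 0"
    and Ss: "b s z = 0" "b s z' = 0" "b s v\<^sub>2 = 0" "b z s = 0" "b z' s = 0" "b v\<^sub>2 s = 0" "b s p0 = 0"
    by (auto intro: S)
  have v0s: "b v0 s = 0" using sv0 b_commute[of v0 s] by simp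
  have y12: "b y1 v0 = 0" "b y2 v0 = 0" "b y1 s = 0" "b y2 s = 0" "b v0 y1 = 0" "b v0 y2 = 0" "b s y1 = 0" "b s y2 = 0"
    "b y1 y1 = e" "b y2 y2 = e" "b y1 y2 = 0" "b y2 y1 = 0"
    using y[of y1] y[of y2] sorted b_commute[of v0 y1] b_commute[of v0 y2] b_commute[of s y1] b_commute[of s y2]
      b_commute[of y2 y1] by auto
  have v1y: "b y1 v\<^sub>1 = r' * c1 * e" "b y2 v\<^sub>1 = r' * c2 * e" "b v0 v\<^sub>1 = r' * s0 * e" "b s v\<^sub>1 = 0"
    using S[of y1] S[of y2] Sv0 Ss y12 v0 sv0 vv by (subst v1; simp)+
  have v1z: "b z' v\<^sub>1 = 0" "b z' v\<^sub>2 = 0" "b v\<^sub>2 v\<^sub>1 = a * e"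
    using vz' a b_commute[of z' v\<^sub>1] b_commute[of z' v\<^sub>2] b_commute[of v\<^sub>2 v\<^sub>1] by simp_all
  have perp_p_iff: "perp_p u \<longleftrightarrow> b u p0 = 0" for u
  proof -
    have "\<exists>c. w = c *s p0" if "w \<in> p" for w using p that by blast
    then show ?thesis unfolding perp_p_def using p0 by fastforce
  qed
  let ?ks = "z # y1 # y2 # ys"
  define lin where "lin = (\<lambda>t x i j. t *s z' + x *s v\<^sub>2 + i *s v0 + j *s s)"
  have lin_perp: "b (lin t x i j) k = 0" if "k \<in> set ?ks" for t x i j k
  proof (cases "k = z")
    case True
    then show ?thesis using z' vz Sv0 Ss by (simp add: lin_def)
  next
    case False
    then have k: "k \<in> set (y1 # y2 # ys)" using that by auto
    then have "b z' k = 0" "b v\<^sub>2 k = 0" using S(5,6)[of k] by auto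
    then show ?thesis using y[OF k] b_commute[of v0 k] b_commute[of s k] by (simp add: lin_def)
  qed
  have lin_b: "b (lin t x i j) p0 = - e * t" "b (lin t x i j) v\<^sub>2 = e * x"
    "b (lin t x i j) v\<^sub>1 = e * (a * x + r' * s0 * i)"
    "b (lin t x i j) v0 = e * s0 * i" "b (lin t x i j) s = e * \<kappa> * j" "b (lin t x i j) z' = - e * t"
    "b (lin t x i j) (lin t x i j) = e * (x\<^sup>2 + s0 * i\<^sup>2 + \<kappa> * j\<^sup>2 - t\<^sup>2)" for t x i j
    using z' vp vz' v1z vv Sv0 Ss v0 \<kappa>(2) sv0 v0s v1y
    by (simp_all add: lin_def power2_eq_square algebra_simps)
  have cp: "\<exists>t x i j. u = lin t x i j" if "u \<in> common_perp e (set ?ks)" for u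
    unfolding lin_def by (rule spn) (use that in \<open>auto simp: common_perp_def\<close>)
  have cp_iff: "lin t x i j \<in> common_perp e (set ?ks) \<longleftrightarrow> x\<^sup>2 + s0 * i\<^sup>2 + \<kappa> * j\<^sup>2 - t\<^sup>2 = 1" for t x i j
    using lin_perp[of _ t x i j] e by (auto simp: common_perp_def lin_b(7))
  have "card {u \<in> common_perp e (set ?ks). \<not> perp_p u \<and> b u v\<^sub>2 = 0} = quadric_count s0 \<kappa>"
  proof -
    have "bij_betw (\<lambda>(i, j, t). lin t 0 i j) {(i, j, t). s0 * i\<^sup>2 + \<kappa> * j\<^sup>2 - t\<^sup>2 = 1 \<and> t \<noteq> 0}
       {u \<in> common_perp e (set ?ks). \<not> perp_p u \<and> b u v\<^sub>2 = 0}" (is "bij_betw ?f ?A ?B")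
      unfolding bij_betw_def
    proof (intro conjI inj_onI equalityI)
      fix x y assume "?f x = ?f y"
      moreover obtain i j t i' j' t' where "x = (i, j, t)" "y = (i', j', t')" by (metis prod.exhaust)
      ultimately have "lin t 0 i j = lin t' 0 i' j'" by simp
      from arg_cong[OF this, of "\<lambda>u. (b u v0, b u s, b u p0)"]
      show "x = y" using e s00 \<kappa> \<open>x = _\<close> \<open>y = _\<close> by (simp add: lin_b)
    next
      show "?f ` ?A \<subseteq> ?B" using e by (auto simp: cp_iff[unfolded list.set] perp_p_iff lin_b)
      show "?B \<subseteq> ?f ` ?A"
      proof
        fix u assume u: "u \<in> ?B"
        then obtain t x i j where l: "u = lin t x i j" using cp by blast
        have "x = 0" "t \<noteq> 0" "s0 * i\<^sup>2 + \<kappa> * j\<^sup>2 - t\<^sup>2 = 1"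
          using u e unfolding l by (auto simp: lin_b perp_p_iff cp_iff[unfolded list.set])
        then show "u \<in> ?f ` ?A" using l by (intro image_eqI[of _ _ "(i, j, t)"]) auto
      qed
    qed
    from bij_betw_same_card[OF this] show ?thesis
      unfolding quadric_count_def by (rule sym)
  qed
  moreover have "card {u \<in> common_perp e (set ?ks). \<not> perp_p u \<and> b u v\<^sub>1 = 0} = quadric_count (s0 * g) \<kappa>"
  proof -
    \<comment> \<open>The line \<open>a * x + r' * s0 * i = 0\<close> is parametrised by
      \<open>x = r' * s0 * k\<close> and \<open>i = - (a * k)\<close>; the form restricted to it has
      value \<open>s0 * g\<close>.\<close>
    have val: "(r' * s0 * k)\<^sup>2 + s0 * (- (a * k))\<^sup>2 = s0 * g * k\<^sup>2" for k
    proof -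
      have "(r' * s0 * k)\<^sup>2 + s0 * (- (a * k))\<^sup>2 = s0 * k\<^sup>2 * (s0 * r'\<^sup>2 + a\<^sup>2)" by algebra
      then show ?thesis unfolding r' s0 by (simp add: mult_ac)
    qed
    have van: "a * (r' * s0 * k) = r' * s0 * (a * k)" for k by (simp add: mult_ac)
    note val' = val[unfolded power2_minus]
    have "bij_betw (\<lambda>(k, j, t). lin t (r' * s0 * k) (- (a * k)) j)
       {(k, j, t). s0 * g * k\<^sup>2 + \<kappa> * j\<^sup>2 - t\<^sup>2 = 1 \<and> t \<noteq> 0}
       {u \<in> common_perp e (set ?ks). \<not> perp_p u \<and> b u v\<^sub>1 = 0}" (is "bij_betw ?f ?A ?B")
      unfolding bij_betw_def
    proof (intro conjI inj_onI equalityI)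
      fix x y assume "?f x = ?f y"
      moreover obtain i j t i' j' t' where "x = (i, j, t)" "y = (i', j', t')" by (metis prod.exhaust)
      ultimately have "lin t (r' * s0 * i) (- (a * i)) j = lin t' (r' * s0 * i') (- (a * i')) j'" by simp
      from arg_cong[OF this, of "\<lambda>u. (b u v\<^sub>2, b u s, b u p0)"]
      show "x = y" using e s00 \<kappa> r'0 \<open>x = _\<close> \<open>y = _\<close> by (simp add: lin_b)
    next
      show "?f ` ?A \<subseteq> ?B" using e by (auto simp: cp_iff[unfolded list.set] perp_p_iff lin_b val' van)
      show "?B \<subseteq> ?f ` ?A"
      proof
        fix u assume u: "u \<in> ?B"
        then obtain t x i j where l: "u = lin t x i j" using cp by blast
        have *: "a * x + r' * s0 * i = 0" "t \<noteq> 0" "x\<^sup>2 + s0 * i\<^sup>2 + \<kappa> * j\<^sup>2 - t\<^sup>2 = 1"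
          using u e unfolding l by (auto simp: lin_b perp_p_iff cp_iff[unfolded list.set])
        \<comment> \<open>The parameter is recovered from \<open>x\<close> and not from
          \<open>i\<close>, since \<open>a\<close> may be zero.\<close>
        define k where "k = x / (r' * s0)"
        have k: "x = r' * s0 * k" using r'0 s00 by (simp add: k_def)
        have "r' * s0 * i = r' * s0 * (- (a * k))" using *(1) unfolding k by algebra
        then have i: "i = - (a * k)" using r'0 s00 by (metis mult_eq_0_iff mult_left_cancel)
        show "u \<in> ?f ` ?A" using l *(2,3) unfolding k i val
          by (intro image_eqI[of _ _ "(k, j, t)"]) auto
      qed
    qed
    from bij_betw_same_card[OF this] show ?thesis
      unfolding quadric_count_def by (rule sym)
  qed
  ultimately have neq: "card {u \<in> common_perp e (set ?ks). \<not> perp_p u \<and> b u v\<^sub>1 = 0}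
      \<noteq> card {u \<in> common_perp e (set ?ks). \<not> perp_p u \<and> b u v\<^sub>2 = 0}"
    using quadric_count_neq[OF two s00 \<kappa>(1) g] by simp
  have yperp: "perp_p k" if "k \<in> set (y1 # y2 # ys)" for k
    using S(7)[of k] that perp_p_iff by auto
  have zperp: "\<not> perp_p z" using perp_p_iff z e by simp
  obtain k0 where k0: "k0 \<in> set (y1 # y2 # ys)" "b k0 v\<^sub>1 \<noteq> 0"
  proof (cases "c1 = 0")
    case True
    then show thesis using that[of y2] c v1y(2) r'0 e by auto
  next
    case False
    then show thesis using that[of y1] v1y(1) r'0 e by auto
  qed
  show ?thesis
  proof (rule not_graph_iso_switch[OF _ _ _ _ _ _ _ _ neq])
    show "b k k = e" if "k \<in> set ?ks" for k using that y z by auto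
    show "sorted_wrt (\<lambda>x y. b x y = 0) ?ks" using sorted S(4) by auto
    show "b k v\<^sub>2 = 0" if "k \<in> set ?ks" for k using that S(3) vz b_commute[of z v\<^sub>2] by auto
    show "b k v\<^sub>1 = 0" if "k \<in> set ?ks" "\<not> perp_p k" for k
      using that yperp vz b_commute[of z v\<^sub>1] by auto
    show "k0 \<in> set ?ks" "perp_p k0" "b k0 v\<^sub>1 \<noteq> 0" using k0 yperp by auto
    \<comment> \<open>The vector \<open>z\<close> is excluded because it is not perpendicular to
      \<open>p\<close>. The others are perpendicular to \<open>v0\<close> and to
      \<open>v\<^sub>2\<close>, whereas vectors in the cosets of \<open>v\<^sub>1\<close> and of
      \<open>v\<^sub>2\<close> have nonzero pairing with \<open>v0\<close> and with
      \<open>v\<^sub>2\<close> respectively.\<close>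
    show "pt k \<notin> C v\<^sub>1 \<union> C v\<^sub>2" if k: "k \<in> set ?ks" for k
    proof
      assume kC: "pt k \<in> C v\<^sub>1 \<union> C v\<^sub>2"
      then have ky: "k \<in> set (y1 # y2 # ys)" using perp_p_C k zperp by auto
      have kk: "b k k = e" "b k v0 = 0" "b k v\<^sub>2 = 0" using y[OF ky] S(3)[of k] ky by auto
      have "k = 0" using kC
      proof
        assume "pt k \<in> C v\<^sub>1"
        then obtain w where w: "w \<in> p" "pt k = pt (v\<^sub>1 + w)" by blast
        obtain d where d: "k = d *s (v\<^sub>1 + w)" using pt_eqD[OF w(2)] .
        have "b w v0 = 0" using w(1) Sv0(7) b_commute[of p0 v0] unfolding p by auto
        then have "d * (r' * s0 * e) = 0" using kk(2) d v1y(3) b_commute[of v\<^sub>1 v0] by simp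
        then show "k = 0" using d r'0 s00 e by simp
      next
        assume "pt k \<in> C v\<^sub>2"
        then obtain w where w: "w \<in> p" "pt k = pt (v\<^sub>2 + w)" by blast
        obtain d where d: "k = d *s (v\<^sub>2 + w)" using pt_eqD[OF w(2)] .
        then have "d * e = 0" using kk(3) w(1) reps2 vv by simp
        then show "k = 0" using d e by simp
      qed
      then show False using kk(1) e by simp
    qed
  qed
qed

end

subsection \<open>The induced form on the quotient\<close>

lemma hyperplane_complement:
  fixes p L :: "('a::field ^ 'n) set"
  assumes "vec.subspace p" "vec.subspace L" "p \<subseteq> L" "vec.dim L = Suc (vec.dim p)"
    and v: "v \<in> L" "v \<notin> p" and x: "x \<in> L"
  obtains c where "x - c *s v \<in> p"
proof -
  have sp: "vec.span p = p" using assms(1) by (simp add: vec.span_eq_iff)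
  have "vec.span (insert v p) = L"
  proof (rule vec.subspace_dim_equal)
    show "vec.span (insert v p) \<subseteq> L" using assms by (intro vec.span_minimal) auto
    have "v \<notin> vec.span p" unfolding sp by fact
    then show "vec.dim L \<le> vec.dim (vec.span (insert v p))"
      using assms(4) by (simp add: vec.dim_insert)
  qed (use assms in auto)
  with x have "\<exists>c. x - c *s v \<in> p" by (auto simp: vec.span_insert sp)
  with that show thesis by blast
qed

context quadratic_space
begin

lemma dim_pt: "v \<noteq> 0 \<Longrightarrow> vec.dim (pt v) = 1"
  by (simp add: pt_def vec.dim_insert)

lemma pt_mem_points: "v \<noteq> 0 \<Longrightarrow> pt v \<in> points"
  using dim_pt subspace_pt by (simp add: points_def)

lemma eq_pt_if_dim_1:
  assumes "vec.subspace x" "vec.dim x = 1" "u \<in> x" "u \<noteq> 0"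
  shows "x = pt u"
proof (rule vec.subspace_dim_equal[symmetric])
  show "pt u \<subseteq> x" using pt_subset_subspace[OF assms(1)] assms(3) by blast
  show "vec.dim x \<le> vec.dim (pt u)" using dim_pt[OF assms(4)] assms(2) by simp
qed (use assms subspace_pt in auto)

text \<open>A vector of \<open>L\<close> outside \<open>p\<close> has a nonzero coefficient at
  \<open>v\<close>; dividing by it moves the vector into the coset of \<open>v\<close>.\<close>

lemma points_diff_eq:
  assumes L: "vec.subspace L" "vec.subspace L'" and p: "p = L \<inter> L'" "vec.dim L = Suc (vec.dim p)"
    and v: "v \<in> L" "v \<notin> p"
  shows "{x \<in> points. x \<subseteq> L \<and> \<not> x \<subseteq> L'} = (\<lambda>w. pt (v + w)) ` p"
proof (intro equalityI subsetI)
  have sub: "vec.subspace p" using vec.subspace_inter[OF L] p(1) by simp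
  fix x assume "x \<in> {x \<in> points. x \<subseteq> L \<and> \<not> x \<subseteq> L'}"
  then have x: "vec.subspace x" "vec.dim x = 1" "x \<subseteq> L" "\<not> x \<subseteq> L'" by (auto simp: points_def)
  then obtain u where u: "u \<in> x" "u \<notin> L'" by blast
  have "u \<noteq> 0" using u(2) vec.subspace_0[OF L(2)] by auto
  then have xu: "x = pt u" using eq_pt_if_dim_1 x u by blast
  have "u \<in> L" using u x(3) by blast
  obtain c where c: "u - c *s v \<in> p"
    using hyperplane_complement[OF sub L(1) _ p(2) v \<open>u \<in> L\<close>] p(1) by auto
  have c0: "c \<noteq> 0" using c u(2) p(1) by auto
  have "u = c *s (v + (1 / c) *s (u - c *s v))"
    using c0 by (simp add: vec_eq_iff field_simps)
  then have "pt u = pt (v + (1 / c) *s (u - c *s v))" using pt_scale[OF c0] by metis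
  moreover have "(1 / c) *s (u - c *s v) \<in> p" by (rule vec.subspace_scale[OF sub c])
  ultimately show "x \<in> (\<lambda>w. pt (v + w)) ` p" unfolding xu by blast
next
  have sub: "vec.subspace p" using vec.subspace_inter[OF L] p(1) by simp
  fix x assume "x \<in> (\<lambda>w. pt (v + w)) ` p"
  then obtain w where w: "w \<in> p" "x = pt (v + w)" by blast
  have "v + w \<in> L" using w v p(1) L(1) by (auto intro: vec.subspace_add)
  moreover have "v + w \<notin> L'"
  proof
    assume "v + w \<in> L'"
    then have "v + w \<in> p" using p(1) \<open>v + w \<in> L\<close> by blast
    then have "v + w - w \<in> p" using w(1) sub vec.subspace_diff by blast
    with v show False by simp
  qed
  moreover from this have "v + w \<noteq> 0" using vec.subspace_0[OF L(2)] by auto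
  ultimately show "x \<in> {x \<in> points. x \<subseteq> L \<and> \<not> x \<subseteq> L'}"
    unfolding w(2) using pt_mem_points L by (simp add: pt_subset_subspace)
qed

end

context tangent_pair
begin

text \<open>Completing the square, the form on the quotient is
  \<open>e * ((d + a * c)\<^sup>2 + (1 - a\<^sup>2) * c\<^sup>2)\<close>. Nondegeneracy gives
  \<open>1 - a\<^sup>2 \<noteq> 0\<close>, and a singular vector exists exactly when
  \<open>- (1 - a\<^sup>2)\<close> is a square. Since -1 is a square exactly for q = 1 mod 4, the
  prescribed type makes \<open>1 - a\<^sup>2\<close> a square in both cases.\<close>

lemma discriminant_square:
  assumes P: "\<And>x. x \<in> P \<longleftrightarrow> (\<exists>c d. \<exists>w\<in>p. x = c *s v\<^sub>1 + d *s v\<^sub>2 + w)"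
    and indep: "\<And>c d. c *s v\<^sub>1 + d *s v\<^sub>2 \<in> p \<Longrightarrow> c = 0 \<and> d = 0"
    and \<tau>: "type_O2 (if CARD('a) mod 4 = 3 then Neg else Pos) \<tau>" "quotient_isometric \<sigma> P p \<tau>"
    and odd: "odd CARD('a)"
    and a: "b v\<^sub>1 v\<^sub>2 = e * a"
  obtains r where "r \<noteq> 0" "a\<^sup>2 + r\<^sup>2 = 1"
proof -
  obtain \<phi> where \<phi>: "bij_betw \<phi> ((\<lambda>v. v +o p) ` P) UNIV"
    "\<And>u v. u \<in> P \<Longrightarrow> v \<in> P \<Longrightarrow> \<phi> ((u + v) +o p) = \<phi> (u +o p) + \<phi> (v +o p)"
    "\<And>c v. v \<in> P \<Longrightarrow> \<phi> ((c *s v) +o p) = c *s \<phi> (v +o p)"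
    "\<And>v. v \<in> P \<Longrightarrow> \<tau> (\<phi> (v +o p)) = \<sigma> v"
    using \<tau>(2) unfolding quotient_isometric_def by blast
  define \<psi> where "\<psi> v = \<phi> (v +o p)" for v
  have memP: "c *s v\<^sub>1 + d *s v\<^sub>2 \<in> P" for c d
  proof -
    have "c *s v\<^sub>1 + d *s v\<^sub>2 = c *s v\<^sub>1 + d *s v\<^sub>2 + 0" by simp
    with zero_mem show ?thesis using P by blast
  qed
  have zP: "0 \<in> P" using memP[of 0 0] by simp
  have \<psi>0: "\<psi> 0 = 0" using \<phi>(3)[OF zP, of 0] by (simp add: \<psi>_def)
  have ker: "v \<in> p" if "v \<in> P" "\<psi> v = 0" for v
  proof -
    have "\<phi> (v +o p) = \<phi> (0 +o p)" using that \<psi>0 by (simp add: \<psi>_def)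
    then have "v +o p = 0 +o p"
      by (rule inj_onD[OF bij_betw_imp_inj_on[OF \<phi>(1)]]) (rule image_eqI[OF refl that(1)], rule image_eqI[OF refl zP])
    moreover have "v + 0 \<in> v +o p" using zero_mem by (rule set_plus_intro2)
    ultimately show ?thesis by simp
  qed
  have surj: "\<exists>x\<in>P. \<psi> x = y" for y
  proof -
    have "y \<in> \<phi> ` (\<lambda>v. v +o p) ` P" using bij_betw_imp_surj_on[OF \<phi>(1)] by simp
    then show ?thesis unfolding \<psi>_def by blast
  qed
  have \<tau>b: "\<tau> (\<psi> v) = b v v" if "v \<in> P" for v using \<phi>(4)[OF that] by (simp add: \<psi>_def b_self)
  have a': "b v\<^sub>2 v\<^sub>1 = e * a" using a b_commute[of v\<^sub>2 v\<^sub>1] by simp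
  have addP: "u + v \<in> P" if "u \<in> P" "v \<in> P" for u v
  proof -
    obtain c d w c' d' w' where w: "w \<in> p" "w' \<in> p"
      and "u = c *s v\<^sub>1 + d *s v\<^sub>2 + w" "v = c' *s v\<^sub>1 + d' *s v\<^sub>2 + w'"
      using \<open>u \<in> P\<close> \<open>v \<in> P\<close> P[of u] P[of v] by blast
    then have "u + v = (c + c') *s v\<^sub>1 + (d + d') *s v\<^sub>2 + (w + w')"
      by (simp add: vec_eq_iff algebra_simps)
    moreover have "w + w' \<in> p" using sub w by (rule vec.subspace_add)
    ultimately show ?thesis using P[of "u + v"] by blast
  qed
  have form_P: "b (c *s v\<^sub>1 + d *s v\<^sub>2 + w) (c *s v\<^sub>1 + d *s v\<^sub>2 + w) = e * ((d + a * c)\<^sup>2 + (1 - a\<^sup>2) * c\<^sup>2)"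
    if "w \<in> p" for c d w
    using that vv a a' reps1 reps2 by (simp add: power2_eq_square algebra_simps)
  have D0: "1 - a\<^sup>2 \<noteq> 0"
  proof
    assume D: "1 - a\<^sup>2 = 0"
    \<comment> \<open>If \<open>1 - a\<^sup>2\<close> vanished, this vector would be perpendicular
      to all of \<open>P\<close>, and its nonzero image would lie in the radical of
      \<open>\<tau>\<close>.\<close>
    define d where "d = 1 *s v\<^sub>1 + (- a) *s v\<^sub>2"
    have dP: "d \<in> P" unfolding d_def by (rule memP)
    have "b d x = 0" if "x \<in> P" for x
    proof -
      obtain c k w where w: "w \<in> p" "x = c *s v\<^sub>1 + k *s v\<^sub>2 + w" using \<open>x \<in> P\<close> P by blast
      then have "b d x = c * e * (1 - a\<^sup>2)"
        using vv a a' reps1 reps2 by (simp add: d_def power2_eq_square algebra_simps)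
      then show ?thesis using D by simp
    qed
    then have "polar \<tau> (\<psi> d) (\<psi> x) = 0" if "x \<in> P" for x
    proof -
      have "\<psi> d + \<psi> x = \<psi> (d + x)" using \<phi>(2)[OF dP that] by (simp add: \<psi>_def)
      then have "polar \<tau> (\<psi> d) (\<psi> x) = b (d + x) (d + x) - b d d - b x x"
        using \<tau>b addP dP that by (simp add: polar_def)
      also have "\<dots> = 0" using \<open>\<And>x. x \<in> P \<Longrightarrow> b d x = 0\<close>[OF that] b_commute[of x d] by simp
      finally show ?thesis .
    qed
    then have "polar \<tau> (\<psi> d) y = 0" for y using surj[of y] by blast
    then have "\<psi> d \<in> perp \<tau> UNIV" unfolding perp_def by simp
    then have "\<psi> d = 0" using \<tau>(1) by (simp add: type_O2_def nondegenerate_def)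
    then have "d \<in> p" using ker dP by blast
    then show False using indep[of 1 "- a"] unfolding d_def by simp
  qed
  have "is_square (1 - a\<^sup>2)"
  proof (cases "CARD('a) mod 4 = 3")
    case True
    then have m1: "\<not> is_square (-1 :: 'a)" using is_square_minus_one_iff[OF two] by simp
    show ?thesis
    proof (rule ccontr)
      assume "\<not> ?thesis"
      then have "is_square ((-1) * (1 - a\<^sup>2))" by (rule nonsquare_mult_nonsquare[OF two m1])
      then obtain k where k: "(-1) * (1 - a\<^sup>2) = k\<^sup>2" unfolding is_nth_power_def by blast
      \<comment> \<open>Solves \<open>d + a * c = k\<close> with \<open>c = 1\<close>, giving a
        singular vector outside \<open>p\<close> and contradicting the anisotropic type.\<close>
      define x where "x = 1 *s v\<^sub>1 + (k - a) *s v\<^sub>2"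
      have "b x x = e * ((k - a + a * 1)\<^sup>2 + (1 - a\<^sup>2) * 1\<^sup>2)"
        using form_P[OF zero_mem, of 1 "k - a"] by (simp add: x_def)
      also have "\<dots> = e * (k\<^sup>2 + (1 - a\<^sup>2))" by simp
      also have "\<dots> = 0" unfolding k[symmetric] by simp
      finally have "b x x = 0" .
      moreover have "x \<in> P" unfolding x_def by (rule memP)
      ultimately have "\<tau> (\<psi> x) = 0" using \<tau>b by simp
      moreover have "\<psi> x \<noteq> 0"
      proof
        assume "\<psi> x = 0"
        then have "x \<in> p" using ker \<open>x \<in> P\<close> by blast
        then show False using indep[of 1 "k - a"] unfolding x_def by simp
      qed
      ultimately show False using \<tau>(1) True by (auto simp: type_O2_def)
    qed
  next
    case False
    then have "CARD('a) mod 4 = 1" using odd by presburger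
    then have "is_square (-1 :: 'a)" using is_square_minus_one_iff[OF two] by simp
    then obtain i :: 'a where i: "-1 = i\<^sup>2" unfolding is_nth_power_def by blast
    obtain y where y: "y \<noteq> 0" "\<tau> y = 0" using \<tau>(1) False by (auto simp: type_O2_def)
    obtain x where x: "x \<in> P" "\<psi> x = y" using surj by blast
    obtain c d w where w: "w \<in> p" "x = c *s v\<^sub>1 + d *s v\<^sub>2 + w" using x(1) P by blast
    have "e * ((d + a * c)\<^sup>2 + (1 - a\<^sup>2) * c\<^sup>2) = 0"
      using form_P[OF w(1), of c d] \<tau>b[OF x(1)] x(2) y(2) w(2) by simp
    then have eq: "(d + a * c)\<^sup>2 + (1 - a\<^sup>2) * c\<^sup>2 = 0" using e by simp
    \<comment> \<open>With \<open>c = 0\<close> also \<open>d = 0\<close>, so \<open>x\<close> would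
      lie in \<open>p\<close> and its image \<open>y\<close> would be zero.\<close>
    have "c \<noteq> 0"
    proof
      assume c: "c = 0"
      then have "d = 0" using eq by simp
      then have "x \<in> p" using c w by simp
      moreover have "v +o p = 0 +o p" if "v \<in> p" for v
      proof -
        have "v +o p = p"
        proof (intro equalityI subsetI)
          fix u assume "u \<in> v +o p"
          then show "u \<in> p" using that sub by (auto simp: elt_set_plus_def vec.subspace_add)
        next
          fix u assume "u \<in> p"
          then have "u - v \<in> p" using that sub by (simp add: vec.subspace_diff)
          then have "v + (u - v) \<in> v +o p" by (rule set_plus_intro2)
          then show "u \<in> v +o p" by simp
        qed
        then show ?thesis by simp
      qed
      ultimately have "y = 0" using x(2) \<psi>0 unfolding \<psi>_def by simp
      with y show False by simp
    qed
    have "(1 - a\<^sup>2) * c\<^sup>2 = (-1) * (d + a * c)\<^sup>2" using eq by (simp add: eq_neg_iff_add_eq_0 add.commute)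
    also have "\<dots> = (i * (d + a * c))\<^sup>2" unfolding i by (simp add: power_mult_distrib)
    finally have "1 - a\<^sup>2 = (i * (d + a * c) / c)\<^sup>2" using \<open>c \<noteq> 0\<close>
      by (simp add: power_divide field_simps)
    then show ?thesis unfolding is_nth_power_def by blast
  qed
  then obtain r where r: "1 - a\<^sup>2 = r\<^sup>2" unfolding is_nth_power_def by blast
  show thesis
  proof
    show "r \<noteq> 0" using r D0 by auto
    show "a\<^sup>2 + r\<^sup>2 = 1" using r by (simp add: algebra_simps)
  qed
qed

end

section \<open>Normalising the given subspaces\<close>

theorem theorem10:
  fixes \<sigma> :: "'a::{field,finite} ^ 'n \<Rightarrow> 'a"
    and q n d m :: nat
    and \<epsilon> \<delta> :: sign
    and L\<^sub>1 L\<^sub>2 p P :: "('a ^ 'n) set"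
    and C\<^sub>1 C\<^sub>2 :: "('a ^ 'n) set set"
  assumes q: "q = CARD('a)" "q \<ge> 3" "odd q"
    and n: "n = CARD('n)"
    and d: "d \<ge> 2"
    and type: "type_O_odd d \<sigma> \<or> type_O_plus d \<sigma> \<or> type_O_minus d \<sigma>"
    and m: "3 \<le> m" "m \<le> d"
    and L\<^sub>1: "vec.subspace L\<^sub>1" "vec.dim L\<^sub>1 = m - 1" "\<not> totally_isotropic \<sigma> L\<^sub>1"
    and L\<^sub>2: "vec.subspace L\<^sub>2" "vec.dim L\<^sub>2 = m - 1" "\<not> totally_isotropic \<sigma> L\<^sub>2"
    and p: "p = L\<^sub>1 \<inter> L\<^sub>2" "vec.dim p = m - 2"
      "p = L\<^sub>1 \<inter> perp \<sigma> L\<^sub>1" "p = L\<^sub>2 \<inter> perp \<sigma> L\<^sub>2"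
    and P: "P = L\<^sub>1 + L\<^sub>2"
    and C\<^sub>1: "C\<^sub>1 = {x \<in> points. x \<subseteq> L\<^sub>1 \<and> \<not> x \<subseteq> L\<^sub>2}"
    and C\<^sub>2: "C\<^sub>2 = {x \<in> points. x \<subseteq> L\<^sub>2 \<and> \<not> x \<subseteq> L\<^sub>1}"
    and C: "C\<^sub>1 \<union> C\<^sub>2 \<subseteq> points_of_sign \<sigma> \<epsilon>"
    and \<delta>: "\<delta> = (if q mod 4 = 3 then Neg else Pos)"
  shows "switching_set (polar_graph \<sigma> \<epsilon>) C\<^sub>1 C\<^sub>2 \<and>
    (m = 3 \<and> (\<exists>\<tau>. type_O2 \<delta> \<tau> \<and> quotient_isometric \<sigma> P p \<tau>) \<and> n \<ge> 7 \<longrightarrow>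
      \<not> graph_iso (switch (polar_graph \<sigma> \<epsilon>) C\<^sub>1 C\<^sub>2) (polar_graph \<sigma> \<epsilon>))"
proof -
  have form: "quadratic_form \<sigma>" "nondegenerate \<sigma>"
    using type by (auto simp: type_O_odd_def type_O_plus_def type_O_minus_def)
  have two: "(2::'a) \<noteq> 0" using q two_nonzero_if_odd_card[where 'a = 'a] by simp
  interpret quadratic_space \<sigma> using form two by unfold_locales
  have sub: "vec.subspace p" unfolding p(1) by (rule vec.subspace_inter[OF L\<^sub>1(1) L\<^sub>2(1)])
  have pL: "p \<subseteq> L\<^sub>1" "p \<subseteq> L\<^sub>2" using p(1) by blast+
  have dims: "vec.dim L\<^sub>1 = Suc (vec.dim p)" "vec.dim L\<^sub>2 = Suc (vec.dim p)"
    using L\<^sub>1(2) L\<^sub>2(2) p(2) m by simp_all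
  have bp: "b w x = 0" if "w \<in> p" "x \<in> L\<^sub>1 \<union> L\<^sub>2" for w x
  proof -
    have "w \<in> L\<^sub>1 \<inter> perp \<sigma> L\<^sub>1" using \<open>w \<in> p\<close> p(3) by simp
    moreover have "w \<in> L\<^sub>2 \<inter> perp \<sigma> L\<^sub>2" using \<open>w \<in> p\<close> p(4) by simp
    ultimately show ?thesis using that(2) mem_perp_iff by blast
  qed
  have p21: "p = L\<^sub>2 \<inter> L\<^sub>1" using p(1) by blast
  have C1: "C\<^sub>1 = (\<lambda>w. pt (v + w)) ` p" if "v \<in> L\<^sub>1" "v \<notin> p" for v
    unfolding C\<^sub>1 by (rule points_diff_eq[OF L\<^sub>1(1) L\<^sub>2(1) p(1) dims(1) that])
  have C2: "C\<^sub>2 = (\<lambda>w. pt (v + w)) ` p" if "v \<in> L\<^sub>2" "v \<notin> p" for v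
    unfolding C\<^sub>2 by (rule points_diff_eq[OF L\<^sub>2(1) L\<^sub>1(1) p21 dims(2) that])
  have "L\<^sub>1 \<noteq> p" "L\<^sub>2 \<noteq> p" using dims by auto
  then obtain u\<^sub>1 u\<^sub>2 where u1: "u\<^sub>1 \<in> L\<^sub>1" "u\<^sub>1 \<notin> p" and u2: "u\<^sub>2 \<in> L\<^sub>2" "u\<^sub>2 \<notin> p"
    using pL by blast
  have z: "0 \<in> p" by (rule vec.subspace_0[OF sub])
  have mem: "pt u\<^sub>1 \<in> points_of_sign \<sigma> \<epsilon>" "pt u\<^sub>2 \<in> points_of_sign \<sigma> \<epsilon>"
    using image_eqI[OF _ z, of "pt u\<^sub>1" "\<lambda>w. pt (u\<^sub>1 + w)"] image_eqI[OF _ z, of "pt u\<^sub>2" "\<lambda>w. pt (u\<^sub>2 + w)"]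
      C C1[OF u1] C2[OF u2] by auto
  \<comment> \<open>The value of one vector of \<open>L\<^sub>2\<close> outside \<open>p\<close>
    fixes the level; the vector from \<open>L\<^sub>1\<close> is then rescaled to the same
    value.\<close>
  define e where "e = b u\<^sub>2 u\<^sub>2"
  have e: "e \<noteq> 0" and V: "points_of_sign \<sigma> \<epsilon> = pt ` {v. b v v = e}"
    using points_of_sign_eq_level_set[OF mem(2) e_def[symmetric]] by blast+
  obtain v\<^sub>1 where v1: "pt u\<^sub>1 = pt v\<^sub>1" "b v\<^sub>1 v\<^sub>1 = e" using mem(1) unfolding V by blast
  have v1L: "v\<^sub>1 \<in> L\<^sub>1"
    using v1(1) u1(1) pt_subset_subspace[OF L\<^sub>1(1)] by blast
  have np: "v \<notin> p" if "b v v = e" for v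
    using that e bp pL by blast
  \<comment> \<open>Kept general in the representatives: any pair suffices for the switching set,
    while the second part needs representatives perpendicular to \<open>z\<close>.\<close>
  have tp: "tangent_pair \<sigma> e x y p"
    if "x \<in> L\<^sub>1" "b x x = e" "y \<in> L\<^sub>2" "b y y = e" for x y
  proof
    show "e \<noteq> 0" by fact
    show "vec.subspace p" by fact
    show "b w w' = 0" if "w \<in> p" "w' \<in> p" for w w' using bp[OF that(1)] that(2) pL by blast
    show "b w x = 0" "b w y = 0" if "w \<in> p" for w using bp[OF that] \<open>x \<in> L\<^sub>1\<close> \<open>y \<in> L\<^sub>2\<close> by blast+
    show "b x x = e" "b y y = e" by fact+
    have "C\<^sub>1 \<inter> C\<^sub>2 = {}" unfolding C\<^sub>1 C\<^sub>2 by blast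
    then show "(\<lambda>w. pt (x + w)) ` p \<inter> (\<lambda>w. pt (y + w)) ` p = {}"
      using C1[OF \<open>x \<in> L\<^sub>1\<close> np[OF \<open>b x x = e\<close>]] C2[OF \<open>y \<in> L\<^sub>2\<close> np[OF \<open>b y y = e\<close>]] by simp
  qed
  have G: "polar_graph \<sigma> \<epsilon> = \<lparr>verts = pt ` {v. b v v = e}, adj = (\<lambda>x y. x \<subseteq> perp \<sigma> y)\<rparr>"
    unfolding polar_graph_def V ..
  show ?thesis
  proof (intro conjI impI)
    show "switching_set (polar_graph \<sigma> \<epsilon>) C\<^sub>1 C\<^sub>2"
      unfolding G C1[OF v1L np[OF v1(2)]] C2[OF u2]
      by (rule tangent_pair.switching_set_tangent_pair[OF tp[OF v1L v1(2) u2(1) e_def[symmetric]]])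
  next
    assume "m = 3 \<and> (\<exists>\<tau>. type_O2 \<delta> \<tau> \<and> quotient_isometric \<sigma> P p \<tau>) \<and> n \<ge> 7"
    then obtain \<tau> where m3: "m = 3" and \<tau>: "type_O2 \<delta> \<tau>" "quotient_isometric \<sigma> P p \<tau>" and n7: "n \<ge> 7"
      by blast
    have dp: "vec.dim p = 1" using p(2) m3 by simp
    then obtain p0 where p0: "p0 \<in> p" "p0 \<noteq> 0"
      using vec.dim_eq_0[of p] by auto
    have p_range: "p = range (\<lambda>c. c *s p0)"
      using eq_pt_if_dim_1[OF sub dp p0] by (simp add: pt_eq)
    obtain t where t: "b t p0 \<noteq> 0" using b_nondegenerate[of p0] p0(2) b_commute by metis
    define t' where "t' = (e / b t p0) *s t"
    have t': "b t' p0 = e" "b p0 t' = e" using t b_commute[of p0 t'] by (simp_all add: t'_def)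
    have p00: "b p0 p0 = 0" using bp p0 pL by blast
    \<comment> \<open>Adding a multiple of the singular vector \<open>p0\<close> keeps the pairing
      with \<open>p0\<close> and shifts the value of \<open>t'\<close> to \<open>e\<close>.\<close>
    define z where "z = t' + ((e - b t' t') / (2 * e)) *s p0"
    have zz: "b z z = e" "b z p0 = e" "b p0 z = e"
      using t' p00 e two by (simp_all add: z_def field_simps)
    \<comment> \<open>Because \<open>p0\<close> is perpendicular to \<open>L\<^sub>1\<close> and
      \<open>L\<^sub>2\<close>, subtracting multiples of it makes the representatives perpendicular
      to \<open>z\<close> without changing their values.\<close>
    define x where "x = v\<^sub>1 - (b v\<^sub>1 z / e) *s p0"
    define y where "y = u\<^sub>2 - (b u\<^sub>2 z / e) *s p0"
    have pv: "b p0 v\<^sub>1 = 0" "b v\<^sub>1 p0 = 0" "b p0 u\<^sub>2 = 0" "b u\<^sub>2 p0 = 0"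
      using bp[OF p0(1)] v1L u2(1) b_commute[of v\<^sub>1 p0] b_commute[of u\<^sub>2 p0] by auto
    have x: "x \<in> L\<^sub>1" "b x x = e" "b x z = 0"
      using v1L p0(1) pL(1) L\<^sub>1(1) v1(2) pv p00 zz e
      by (auto simp: x_def intro!: vec.subspace_diff vec.subspace_scale)
    have y: "y \<in> L\<^sub>2" "b y y = e" "b y z = 0"
      using u2(1) p0(1) pL(2) L\<^sub>2(1) e_def pv p00 zz e
      by (auto simp: y_def intro!: vec.subspace_diff vec.subspace_scale)
    interpret T: tangent_pair \<sigma> e x y p by (rule tp[OF x(1,2) y(1,2)])
    define a where "a = b x y / e"
    have a: "b x y = e * a" using e by (simp add: a_def)
    have Pmem: "v \<in> P \<longleftrightarrow> (\<exists>c d. \<exists>w\<in>p. v = c *s x + d *s y + w)" for v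
    proof
      assume "v \<in> P"
      then obtain l1 l2 where l: "l1 \<in> L\<^sub>1" "l2 \<in> L\<^sub>2" "v = l1 + l2" unfolding P by (rule set_plus_elim)
      obtain c where c: "l1 - c *s x \<in> p"
        by (rule hyperplane_complement[OF sub L\<^sub>1(1) pL(1) dims(1) x(1) np[OF x(2)] l(1)])
      obtain d where d: "l2 - d *s y \<in> p"
        by (rule hyperplane_complement[OF sub L\<^sub>2(1) pL(2) dims(2) y(1) np[OF y(2)] l(2)])
      have "v = c *s x + d *s y + ((l1 - c *s x) + (l2 - d *s y))" using l(3) by simp
      then show "\<exists>c d. \<exists>w\<in>p. v = c *s x + d *s y + w" using vec.subspace_add[OF sub c d] by blast
    next
      assume "\<exists>c d. \<exists>w\<in>p. v = c *s x + d *s y + w"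
      then obtain c d w where w: "w \<in> p" "v = c *s x + d *s y + w" by blast
      have "c *s x \<in> L\<^sub>1" using L\<^sub>1(1) x(1) by (rule vec.subspace_scale)
      moreover have "d *s y + w \<in> L\<^sub>2"
        using w(1) pL(2) L\<^sub>2(1) y(1) by (auto intro!: vec.subspace_add vec.subspace_scale)
      ultimately have "c *s x + (d *s y + w) \<in> P" unfolding P by (rule set_plus_intro)
      then show "v \<in> P" using w(2) by (simp add: add.assoc)
    qed
    have indep: "c = 0 \<and> d = 0" if cd: "c *s x + d *s y \<in> p" for c d
    proof -
      have c: "c = 0"
      proof (rule ccontr)
        assume c: "c \<noteq> 0"
        have "c *s x + d *s y - d *s y \<in> L\<^sub>2"
          using cd pL(2) L\<^sub>2(1) y(1) by (intro vec.subspace_diff vec.subspace_scale) auto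
        then have "c *s x \<in> L\<^sub>2" by simp
        from vec.subspace_scale[OF L\<^sub>2(1) this, of "1 / c"] have "x \<in> p" using c x(1) p(1) by simp
        with np[OF x(2)] show False by blast
      qed
      have "d = 0"
      proof (rule ccontr)
        assume d: "d \<noteq> 0"
        have "d *s y \<in> p" using cd c by simp
        from vec.subspace_scale[OF sub this, of "1 / d"] have "y \<in> p" using d by simp
        with np[OF y(2)] show False by blast
      qed
      with c show ?thesis by blast
    qed
    have \<tau>1: "type_O2 (if CARD('a) mod 4 = 3 then Neg else Pos) \<tau>" using \<tau>(1) \<delta> q(1) by simp
    have odd: "odd CARD('a)" using q by simp
    obtain r where r: "r \<noteq> 0" "a\<^sup>2 + r\<^sup>2 = 1"
      using T.discriminant_square[OF Pmem indep \<tau>1 \<tau>(2) odd a] by blast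
    have card: "CARD('n) \<ge> 7" using n7 n by simp
    show "\<not> graph_iso (switch (polar_graph \<sigma> \<epsilon>) C\<^sub>1 C\<^sub>2) (polar_graph \<sigma> \<epsilon>)"
      unfolding G C1[OF x(1) np[OF x(2)]] C2[OF y(1) np[OF y(2)]]
      by (rule T.switch_not_iso[OF card p_range zz(1,2) x(3) y(3) a r])
  qed
qed

end
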